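(* Let $\{T_w\}_{w\in\Omega}$ be a continuous operator frame for $End_{\mathcal A}^{*}(\mathcal H)$ with bounds $A$ and $B$, and let $\{R_w\}_{w\in\Omega}\subset End_{\mathcal A}^{*}(\mathcal H)$. The following statements are equivalent: (i) $\{R_w\}_{w\in\Omega}$ is a continuous operator frame for $End_{\mathcal A}^{*}(\mathcal H)$. (ii) There exists a constant $M>0$ such that for all $x\in\mathcal H$, $$\Big\|\int_\Omega\langle (T_w-R_w)x,(T_w-R_w)x\rangle_{\mathcal A}\,d\mu(w)\Big\|\le M\min\Big(\Big\|\int_\Omega\langle T_wx,T_wx\rangle_{\mathcal A}\,d\mu(w)\Big\|,\ \Big\|\int_\Omega\langle R_wx,R_wx\rangle_{\mathcal A}\,d\mu(w)\Big\|\Big).$$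
   Context: $\mathcal A$ is a unital $C^*$-algebra, $\mathcal H$ is a (left) Hilbert $\mathcal A$-module with $\mathcal A$-valued inner product $\langle\cdot,\cdot\rangle_{\mathcal A}$ ($\mathcal A$-linear in the first variable) and norm $\|x\|=\|\langle x,x\rangle_{\mathcal A}\|^{1/2}$, and $End_{\mathcal A}^{*}(\mathcal H)$ is the set of adjointable operators $\mathcal H\to\mathcal H$. $(\Omega,\mu)$ is a measure space; integrals of Banach-space-valued functions are Bochner integrals. Inequalities between elements of $\mathcal A$ refer to the order given by the positive cone $\mathcal A^+$. A family $\{\Lambda_w\}_{w\in\Omega}\subset End_{\mathcal A}^{*}(\mathcal H)$ is a continuous operator frame for $End_{\mathcal A}^{*}(\mathcal H)$ with bounds $A,B>0$ if (a) for every $x\in\mathcal H$ the map $w\mapsto\Lambda_w x$ is measurable, and (b) for every $x\in\mathcal H$, $A\langle x,x\rangle_{\mathcal A}\le\int_\Omega\langle\Lambda_w x,\Lambda_w x\rangle_{\mathcal A}\,d\mu(w)\le B\langle x,x\rangle_{\mathcal A}$. It is called a continuous operator frame if such $A,B>0$ exist. Convention: for all families of operators considered, $w\mapsto R_wx$ is measurable for each $x\in\mathcal H$, and an inequality involving integrals includes the assertion that these integrals exist. *)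

theory Defs
  imports "HOL-Analysis.Analysis"
begin

section \<open>Unital C*-algebras\<close>

class complex_vector = real_vector +
  fixes scaleC :: "complex \<Rightarrow> 'a \<Rightarrow> 'a"  (infixr \<open>*\<^sub>C\<close> 75)
  assumes scaleC_add_right: "c *\<^sub>C (x + y) = c *\<^sub>C x + c *\<^sub>C y"
    and scaleC_add_left: "(c + d) *\<^sub>C x = c *\<^sub>C x + d *\<^sub>C x"
    and scaleC_scaleC: "c *\<^sub>C d *\<^sub>C x = (c * d) *\<^sub>C x"
    and scaleR_scaleC: "r *\<^sub>R x = complex_of_real r *\<^sub>C x"

class complex_banach = banach + complex_vector +
  assumes norm_scaleC: "norm (c *\<^sub>C x) = cmod c * norm x"

text \<open>The class \<^class>\<open>real_normed_algebra_1\<close> contains \<open>0 \<noteq> 1\<close>, so the zero algebra is not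
  regarded as a unital C*-algebra; \<open>norm 1 = 1\<close> then is a consequence of the C*-identity.\<close>

class unital_cstar_algebra = complex_banach + real_normed_algebra_1 +
  fixes star :: "'a \<Rightarrow> 'a"
  assumes mult_scaleC_left: "(c *\<^sub>C x) * y = c *\<^sub>C (x * y)"
    and mult_scaleC_right: "x * (c *\<^sub>C y) = c *\<^sub>C (x * y)"
    and star_add: "star (x + y) = star x + star y"
    and star_scaleC: "star (c *\<^sub>C x) = cnj c *\<^sub>C star x"
    and star_mult: "star (x * y) = star y * star x"
    and star_star: "star (star x) = x"
    and cstar_identity: "norm (star x * x) = (norm x)\<^sup>2"

definition cstar_spectrum :: "'a::unital_cstar_algebra \<Rightarrow> complex set" where
  "cstar_spectrum a = {z. \<not> (\<exists>b. (z *\<^sub>C 1 - a) * b = 1 \<and> b * (z *\<^sub>C 1 - a) = 1)}"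

definition cstar_positive :: "'a::unital_cstar_algebra \<Rightarrow> bool" where
  "cstar_positive a \<longleftrightarrow> star a = a \<and> cstar_spectrum a \<subseteq> \<real>\<^sub>\<ge>\<^sub>0"

definition cstar_le :: "'a::unital_cstar_algebra \<Rightarrow> 'a \<Rightarrow> bool"  (infix \<open>\<preceq>\<close> 50) where
  "a \<preceq> b \<longleftrightarrow> cstar_positive (b - a)"


section \<open>Hilbert modules\<close>

text \<open>Completeness of the module is part of the sort \<^class>\<open>complex_banach\<close>; the last assumption
  identifies its norm with the one induced by the algebra-valued inner product.\<close>

locale hilbert_cstar_module =
  fixes act :: "'a::unital_cstar_algebra \<Rightarrow> 'h::complex_banach \<Rightarrow> 'h"
    and ip :: "'h \<Rightarrow> 'h \<Rightarrow> 'a"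
  assumes act_add_right: "act a (x + y) = act a x + act a y"
    and act_add_left: "act (a + b) x = act a x + act b x"
    and act_act: "act a (act b x) = act (a * b) x"
    and act_one: "act 1 x = x"
    and act_scaleC_left: "act (c *\<^sub>C a) x = c *\<^sub>C act a x"
    and act_scaleC_right: "act a (c *\<^sub>C x) = c *\<^sub>C act a x"
    and ip_add_left: "ip (x + y) z = ip x z + ip y z"
    and ip_act_left: "ip (act a x) y = a * ip x y"
    and ip_star: "star (ip x y) = ip y x"
    and ip_positive: "cstar_positive (ip x x)"
    and ip_definite: "ip x x = 0 \<Longrightarrow> x = 0"
    and norm_eq_ip: "norm x = sqrt (norm (ip x x))"

definition adjointable_operators :: "('h \<Rightarrow> 'h \<Rightarrow> 'a) \<Rightarrow> ('h \<Rightarrow> 'h) set" where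
  "adjointable_operators ip = {T. \<exists>S. \<forall>x y. ip (T x) y = ip x (S y)}"


section \<open>Bochner integrals in arbitrary Banach spaces\<close>

text \<open>The library's \<^const>\<open>has_bochner_integral\<close> is restricted to second countable spaces.  For
  general Banach spaces, Borel measurability is replaced by strong measurability (almost everywhere
  limits of simple functions); apart from that the definition is the same.\<close>

definition strongly_measurable :: "'w measure \<Rightarrow> ('w \<Rightarrow> 'b::real_normed_vector) \<Rightarrow> bool" where
  "strongly_measurable M f \<longleftrightarrow>
     (\<exists>s. (\<forall>i::nat. simple_function M (s i)) \<and> (AE w in M. (\<lambda>i. s i w) \<longlonglongrightarrow> f w))"

definition has_strong_bochner_integral ::
    "'w measure \<Rightarrow> ('w \<Rightarrow> 'b::real_normed_vector) \<Rightarrow> 'b \<Rightarrow> bool" where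
  "has_strong_bochner_integral M f I \<longleftrightarrow>
     strongly_measurable M f \<and>
     (\<exists>s. (\<forall>i::nat. Bochner_Integration.simple_bochner_integrable M (s i)) \<and>
          (\<lambda>i. \<integral>\<^sup>+w. ennreal (norm (f w - s i w)) \<partial>M) \<longlonglongrightarrow> 0 \<and>
          (\<lambda>i. Bochner_Integration.simple_bochner_integral M (s i)) \<longlonglongrightarrow> I)"

definition strong_bochner_integrable :: "'w measure \<Rightarrow> ('w \<Rightarrow> 'b::real_normed_vector) \<Rightarrow> bool" where
  "strong_bochner_integrable M f \<longleftrightarrow> (\<exists>I. has_strong_bochner_integral M f I)"

definition strong_bochner_integral :: "'w measure \<Rightarrow> ('w \<Rightarrow> 'b::real_normed_vector) \<Rightarrow> 'b" where
  "strong_bochner_integral M f = (THE I. has_strong_bochner_integral M f I)"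


section \<open>Continuous operator frames\<close>

definition measurable_adjointable_family ::
    "'w measure \<Rightarrow> ('h \<Rightarrow> 'h \<Rightarrow> 'a) \<Rightarrow> ('w \<Rightarrow> 'h::real_normed_vector \<Rightarrow> 'h) \<Rightarrow> bool" where
  "measurable_adjointable_family M ip T \<longleftrightarrow>
     (\<forall>w\<in>space M. T w \<in> adjointable_operators ip) \<and>
     (\<forall>x. strongly_measurable M (\<lambda>w. T w x))"

definition continuous_operator_frame_with_bounds ::
    "'w measure \<Rightarrow> ('h \<Rightarrow> 'h \<Rightarrow> 'a::unital_cstar_algebra) \<Rightarrow>
     ('w \<Rightarrow> 'h::real_normed_vector \<Rightarrow> 'h) \<Rightarrow> real \<Rightarrow> real \<Rightarrow> bool" where
  "continuous_operator_frame_with_bounds M ip T A B \<longleftrightarrow>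
     A > 0 \<and> B > 0 \<and>
     measurable_adjointable_family M ip T \<and>
     (\<forall>x. strong_bochner_integrable M (\<lambda>w. ip (T w x) (T w x)) \<and>
          A *\<^sub>R ip x x \<preceq> strong_bochner_integral M (\<lambda>w. ip (T w x) (T w x)) \<and>
          strong_bochner_integral M (\<lambda>w. ip (T w x) (T w x)) \<preceq> B *\<^sub>R ip x x)"

definition continuous_operator_frame ::
    "'w measure \<Rightarrow> ('h \<Rightarrow> 'h \<Rightarrow> 'a::unital_cstar_algebra) \<Rightarrow>
     ('w \<Rightarrow> 'h::real_normed_vector \<Rightarrow> 'h) \<Rightarrow> bool" where
  "continuous_operator_frame M ip T \<longleftrightarrow> (\<exists>A B. continuous_operator_frame_with_bounds M ip T A B)"

end

theory Submission
  imports Defs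
begin

text \<open>Write \<open>F\<^sub>S x\<close> for the integral of \<open>\<langle>S\<^sub>w x, S\<^sub>w x\<rangle>\<close>. The proof rests on the observation that, for a
family \<open>R\<close> with integrable \<open>\<langle>R\<^sub>w x, R\<^sub>w x\<rangle>\<close>, the frame inequalities
\<open>C \<langle>x, x\<rangle> \<le> F\<^sub>R x \<le> D \<langle>x, x\<rangle>\<close> in the algebra are equivalent to the scalar inequalities
\<open>C \<parallel>x\<parallel>\<^sup>2 \<le> \<parallel>F\<^sub>R x\<parallel> \<le> D \<parallel>x\<parallel>\<^sup>2\<close>. Passing from the algebra to scalars is monotonicity of the norm
on positive elements. For the converse, adjointable operators are linear over the algebra, hence
\<open>F\<^sub>R (h x) = h F\<^sub>R(x) h\<close> for self-adjoint \<open>h\<close>; so the scalar inequalities, applied to all \<open>h x\<close>,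
compare \<open>\<parallel>h P h\<parallel>\<close> with \<open>\<parallel>h Q h\<parallel>\<close> for two positive elements \<open>P\<close> and \<open>Q\<close>. The choice
\<open>h = (Q + \<epsilon>)\<^bsup>-1/2\<^esup>\<close> makes \<open>\<parallel>h Q h\<parallel> \<le> 1\<close>, so \<open>h P h \<le> 1\<close>, which after multiplication by
\<open>h\<^bsup>-1\<^esup>\<close> from both sides reads \<open>P \<le> Q + \<epsilon>\<close> (\<open>le_of_norm_conjugate_le\<close>, \<open>frame_boundsI_norm\<close>).

With frames described by scalars, the equivalence is an estimate between norms. From
\<open>\<langle>x + y, x + y\<rangle> + \<langle>x - y, x - y\<rangle> = 2\<langle>x, x\<rangle> + 2\<langle>y, y\<rangle>\<close> one gets, by
positivity of the second term,
\<open>\<parallel>F\<^bsub>S + S'\<^esub> x\<parallel> \<le> 2 \<parallel>F\<^bsub>S\<^esub> x\<parallel> + 2 \<parallel>F\<^bsub>S'\<^esub> x\<parallel>\<close> (\<open>norm_integral_ip_add_le\<close>). Applied to \<open>T - R\<close> it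
bounds \<open>F\<^bsub>T - R\<^esub> x\<close> when both families are frames; applied to \<open>R = T - (T - R)\<close> and \<open>T = (T - R) + R\<close> it
transfers the scalar bounds of \<open>T\<close> to \<open>R\<close>.

Two bodies of theory carry this. For the algebra, positivity is defined by the spectrum, and the key
fact is that \<open>\<parallel>k\<parallel>\<close> or \<open>-\<parallel>k\<parallel>\<close> is a spectral value of a self-adjoint \<open>k\<close>. It comes from
the square roots of \<open>1 - a\<close> that the binomial series provides for \<open>\<parallel>a\<parallel> \<le> 1\<close>
(\<open>norm_less_one_of_unit\<close>), and it describes the positive elements as the self-adjoint \<open>a\<close> with
\<open>\<parallel>t - a\<parallel> \<le> t\<close> for \<open>t = \<parallel>a\<parallel>\<close>, from which it follows that they form a closed convex cone.
For the integral, positivity of the integral of a positive function follows by integrating the distance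
to this cone, which is a sublinear functional bounded by the norm
(\<open>sublinear_has_strong_bochner_integral_zero\<close>).\<close>

section \<open>Complex scalars and the involution\<close>

lemma scaleC_zero [simp]: "c *\<^sub>C (0::'a::complex_vector) = 0"
  using scaleC_add_right[of c 0 "0::'a"] by simp

lemma scaleC_minus_right: "c *\<^sub>C (- x) = - (c *\<^sub>C (x::'a::complex_vector))"
  using scaleC_add_right[of c x "- x"] by (simp add: eq_neg_iff_add_eq_0 add.commute)

lemma scaleC_zero_left [simp]: "0 *\<^sub>C (x::'a::complex_vector) = 0"
  using scaleR_scaleC[of 0 x] by simp

lemma scaleC_minus_left: "(- c) *\<^sub>C (x::'a::complex_vector) = - (c *\<^sub>C x)"
  using scaleC_add_left[of c "- c" x] by (simp add: eq_neg_iff_add_eq_0 add.commute)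

lemma scaleC_diff_left: "(c - d) *\<^sub>C (x::'a::complex_vector) = c *\<^sub>C x - d *\<^sub>C x"
  using scaleC_add_left[of c "- d" x] by (simp add: scaleC_minus_left)

lemma scaleC_diff_right: "c *\<^sub>C (x - y) = c *\<^sub>C x - c *\<^sub>C (y::'a::complex_vector)"
  using scaleC_add_right[of c x "- y"] by (simp add: scaleC_minus_right)

lemma scaleC_one [simp]: "1 *\<^sub>C (x::'a::complex_vector) = x"
  using scaleR_scaleC[of 1 x] by simp

lemma scaleC_of_real: "complex_of_real r *\<^sub>C x = r *\<^sub>R (x::'a::complex_vector)"
  by (simp add: scaleR_scaleC)

lemma star_zero [simp]: "star (0::'a::unital_cstar_algebra) = 0"
  using star_add[of "0::'a" 0] by simp

lemma star_minus: "star (- a) = - star (a::'a::unital_cstar_algebra)"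
  using star_add[of a "- a"] by (simp add: eq_neg_iff_add_eq_0 add.commute)

lemma star_diff: "star (a - b) = star a - star (b::'a::unital_cstar_algebra)"
  using star_add[of a "- b"] by (simp add: star_minus)

lemma star_one [simp]: "star (1::'a::unital_cstar_algebra) = 1"
  by (metis mult_1_right star_mult star_star)

lemma star_scaleR: "star (r *\<^sub>R a) = r *\<^sub>R star (a::'a::unital_cstar_algebra)"
  by (simp add: scaleR_scaleC star_scaleC)

lemma star_power: "star (a ^ n) = star (a::'a::unital_cstar_algebra) ^ n"
  by (induction n) (simp_all add: star_mult power_commutes)

lemma norm_star [simp]: "norm (star a) = norm (a::'a::unital_cstar_algebra)"
proof -
  have le: "norm b \<le> norm (star b)" for b :: 'a
  proof (cases "b = 0")
    case False
    have "norm b * norm b \<le> norm (star b) * norm b"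
      using cstar_identity[of b] norm_mult_ineq[of "star b" b] by (simp add: power2_eq_square)
    with False show ?thesis by simp
  qed simp
  show ?thesis
    using le[of a] le[of "star a"] by (simp add: star_star)
qed

lemma bounded_linear_star: "bounded_linear (star :: 'a::unital_cstar_algebra \<Rightarrow> 'a)"
  by (rule bounded_linear_intro[where K = 1]) (simp_all add: star_add star_scaleR)

section \<open>Two-sided units and the spectrum\<close>

definition bi_unit :: "'a::ring_1 \<Rightarrow> bool" where
  "bi_unit a \<longleftrightarrow> (\<exists>b. a * b = 1 \<and> b * a = 1)"

lemma bi_unit_one: "bi_unit 1"
  unfolding bi_unit_def by (rule exI[of _ 1]) simp

lemma bi_unit_mult: "bi_unit a \<Longrightarrow> bi_unit b \<Longrightarrow> bi_unit (a * b)"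
  unfolding bi_unit_def
proof (elim exE conjE)
  fix u v assume "a * u = 1" "u * a = 1" "b * v = 1" "v * b = 1"
  then have "a * b * (v * u) = 1 \<and> v * u * (a * b) = 1"
    by (metis mult.assoc mult_1_right)
  then show "\<exists>c. a * b * c = 1 \<and> c * (a * b) = 1" by blast
qed

lemma bi_unit_minus: "bi_unit (- a) \<longleftrightarrow> bi_unit a"
  unfolding bi_unit_def by (metis minus_mult_minus minus_minus)

lemma bi_unit_scaleC:
  fixes a :: "'a::unital_cstar_algebra"
  assumes "c \<noteq> 0" shows "bi_unit (c *\<^sub>C a) \<longleftrightarrow> bi_unit a"
proof -
  have *: "bi_unit (c *\<^sub>C a)" if "bi_unit a" "c \<noteq> 0" for c and a :: 'a
  proof -
    from that(1) obtain b where "a * b = 1" "b * a = 1" unfolding bi_unit_def by blast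
    then have "c *\<^sub>C a * (inverse c *\<^sub>C b) = 1 \<and> inverse c *\<^sub>C b * c *\<^sub>C a = 1"
      using that(2) by (simp add: mult_scaleC_left mult_scaleC_right scaleC_scaleC)
    then show ?thesis unfolding bi_unit_def by blast
  qed
  show ?thesis
    using *[of a c] *[of "c *\<^sub>C a" "inverse c"] assms by (auto simp: scaleC_scaleC)
qed

lemma bi_unit_scaleR:
  fixes a :: "'a::unital_cstar_algebra"
  shows "c \<noteq> 0 \<Longrightarrow> bi_unit (c *\<^sub>R a) \<longleftrightarrow> bi_unit a"
  by (simp add: scaleR_scaleC bi_unit_scaleC)

text \<open>The inverse is the Neumann series \<open>\<Sum>n. a ^ n\<close>.\<close>
lemma bi_unit_one_minus:
  fixes a :: "'a::{real_normed_algebra_1,banach}"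
  assumes "norm a < 1" shows "bi_unit (1 - a)"
proof -
  have s: "summable (\<lambda>n. a ^ n)" using assms by (rule complete_algebra_summable_geometric)
  have 1: "(\<Sum>n. a ^ n) = 1 + (\<Sum>n. a ^ Suc n)"
    using suminf_split_head[OF s] by simp
  have "(\<Sum>n. a ^ Suc n) = a * (\<Sum>n. a ^ n)" "(\<Sum>n. a ^ Suc n) = (\<Sum>n. a ^ n) * a"
    using suminf_mult[OF s, of a] suminf_mult2[OF s, of a] by (simp_all add: power_commutes)
  with 1 have "(1 - a) * (\<Sum>n. a ^ n) = 1 \<and> (\<Sum>n. a ^ n) * (1 - a) = 1"
    by (simp add: algebra_simps)
  then show ?thesis unfolding bi_unit_def by blast
qed

lemma spectrum_iff: "z \<in> cstar_spectrum a \<longleftrightarrow> \<not> bi_unit (z *\<^sub>C 1 - a)"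
  by (simp add: cstar_spectrum_def bi_unit_def)

lemma spectrum_of_real_iff: "complex_of_real t \<in> cstar_spectrum a \<longleftrightarrow> \<not> bi_unit (t *\<^sub>R 1 - a)"
  by (simp add: spectrum_iff scaleC_of_real)

lemma spectrum_norm_le:
  assumes "z \<in> cstar_spectrum a" shows "cmod z \<le> norm a"
proof (rule ccontr)
  assume "\<not> ?thesis"
  then have lt: "norm a < cmod z" by simp
  then have z: "z \<noteq> 0" by auto
  have "norm (inverse z *\<^sub>C a) < 1"
    using lt z by (simp add: norm_scaleC norm_inverse divide_inverse[symmetric] mult.commute[of "inverse _"] del: norm_divide)
  then have "bi_unit (z *\<^sub>C (1 - inverse z *\<^sub>C a))"
    using z by (simp add: bi_unit_scaleC bi_unit_one_minus)
  then have "bi_unit (z *\<^sub>C 1 - a)"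
    using z by (simp add: scaleC_diff_right scaleC_scaleC)
  with assms show False by (simp add: spectrum_iff)
qed

lemma spectrum_shift:
  "z \<in> cstar_spectrum (a + c *\<^sub>C 1) \<longleftrightarrow> z - c \<in> cstar_spectrum a"
  by (simp add: spectrum_iff scaleC_diff_left algebra_simps)

lemma spectrum_reflect:
  "z \<in> cstar_spectrum (t *\<^sub>R 1 - a) \<longleftrightarrow> of_real t - z \<in> cstar_spectrum a"
proof -
  have "z *\<^sub>C 1 - (t *\<^sub>R 1 - a) = - ((of_real t - z) *\<^sub>C 1 - a)"
    by (simp add: scaleC_diff_left scaleC_of_real)
  then show ?thesis by (simp only: spectrum_iff bi_unit_minus)
qed

text \<open>Shifting \<open>h\<close> by \<open>il\<close>, with \<open>l\<close> real, moves a spectral value \<open>\<alpha> + i\<beta>\<close> to \<open>\<alpha> + i(\<beta> + l)\<close>, while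
the C*-identity gives \<open>\<parallel>h + il\<parallel>\<^sup>2 = \<parallel>h\<^sup>2 + l\<^sup>2\<parallel> \<le> \<parallel>h\<parallel>\<^sup>2 + l\<^sup>2\<close>. The left side of the resulting
\<open>(\<beta> + l)\<^sup>2 \<le> \<parallel>h\<parallel>\<^sup>2 + l\<^sup>2\<close> grows by \<open>2\<beta>l\<close> relative to the right side, which forces \<open>\<beta> = 0\<close>.\<close>
lemma selfadjoint_spectrum_real:
  assumes sa: "star h = h" and z: "z \<in> cstar_spectrum h"
  shows "Im z = 0"
proof -
  define \<beta> where "\<beta> = Im z"
  have bound: "(\<beta> + l)\<^sup>2 \<le> (norm h)\<^sup>2 + l\<^sup>2" for l :: real
  proof -
    define c where "c = \<i> * of_real l"
    have "z + c \<in> cstar_spectrum (h + c *\<^sub>C 1)" using z by (simp add: spectrum_shift)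
    then have le: "cmod (z + c) \<le> norm (h + c *\<^sub>C 1)" by (rule spectrum_norm_le)
    have st: "star (h + c *\<^sub>C 1) = h - c *\<^sub>C 1"
      by (simp add: star_add star_scaleC sa c_def scaleC_minus_left)
    have "star (h + c *\<^sub>C 1) * (h + c *\<^sub>C 1) = h * h - (c * c) *\<^sub>C 1"
      unfolding st by (simp add: algebra_simps mult_scaleC_left mult_scaleC_right scaleC_scaleC
          scaleC_diff_right)
    also have "c * c = - of_real (l\<^sup>2)"
      by (simp add: c_def power2_eq_square complex_eq_iff)
    finally have "star (h + c *\<^sub>C 1) * (h + c *\<^sub>C 1) = h * h + l\<^sup>2 *\<^sub>R 1"
      by (simp add: scaleC_minus_left scaleC_of_real del: of_real_power)
    then have "(norm (h + c *\<^sub>C 1))\<^sup>2 = norm (h * h + l\<^sup>2 *\<^sub>R 1)"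
      by (metis cstar_identity)
    also have "\<dots> \<le> norm (h * h) + l\<^sup>2"
      by (rule norm_triangle_le) simp
    also have "norm (h * h) = (norm h)\<^sup>2" using cstar_identity[of h] sa by simp
    finally have n: "(norm (h + c *\<^sub>C 1))\<^sup>2 \<le> (norm h)\<^sup>2 + l\<^sup>2" .
    have "\<bar>\<beta> + l\<bar> \<le> cmod (z + c)"
      using abs_Im_le_cmod[of "z + c"] by (simp add: c_def \<beta>_def)
    with le have "\<bar>\<beta> + l\<bar> \<le> norm (h + c *\<^sub>C 1)" by simp
    then have "(\<beta> + l)\<^sup>2 \<le> (norm (h + c *\<^sub>C 1))\<^sup>2"
      by (metis abs_ge_zero power2_abs power_mono)
    with n show ?thesis by simp
  qed
  show ?thesis
  proof (rule ccontr)
    assume "Im z \<noteq> 0"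
    then have b: "\<beta> \<noteq> 0" by (simp add: \<beta>_def)
    \<comment> \<open>this \<open>l\<close> makes the cross term \<open>2\<beta>l\<close> equal to \<open>2\<parallel>h\<parallel>\<^sup>2\<close>\<close>
    have "(\<beta> + (norm h)\<^sup>2 / \<beta>)\<^sup>2 \<le> (norm h)\<^sup>2 + ((norm h)\<^sup>2 / \<beta>)\<^sup>2" by (rule bound)
    moreover have "(\<beta> + (norm h)\<^sup>2 / \<beta>)\<^sup>2 = \<beta>\<^sup>2 + 2 * (norm h)\<^sup>2 + ((norm h)\<^sup>2 / \<beta>)\<^sup>2"
      using b by (simp add: power2_sum)
    ultimately have "\<beta>\<^sup>2 + (norm h)\<^sup>2 \<le> 0" by simp
    with b show False by (smt (verit) zero_le_power2 zero_less_power2)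
  qed
qed

text \<open>The factors of \<open>x\<^sup>2 + t = (x - i\<surd>t)(x + i\<surd>t)\<close> are units because the spectrum of \<open>x\<close> is real.\<close>
lemma bi_unit_square_plus:
  fixes x :: "'a::unital_cstar_algebra"
  assumes sa: "star x = x" and t: "0 < t"
  shows "bi_unit (x * x + t *\<^sub>R 1)"
proof -
  define c where "c = \<i> * of_real (sqrt t)"
  have "c * c = - of_real t"
    using t by (simp add: c_def complex_eq_iff)
  have "c \<notin> cstar_spectrum x" "- c \<notin> cstar_spectrum x"
    using selfadjoint_spectrum_real[OF sa, of c] selfadjoint_spectrum_real[OF sa, of "- c"] t
    by (auto simp: c_def)
  then have "bi_unit (- (c *\<^sub>C 1 - x) * - ((- c) *\<^sub>C 1 - x))"
    by (intro bi_unit_mult) (simp_all only: bi_unit_minus spectrum_iff simp_thms)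
  also have "- (c *\<^sub>C 1 - x) * - ((- c) *\<^sub>C 1 - x) = x * x - (c * c) *\<^sub>C 1"
    by (simp add: algebra_simps mult_scaleC_left mult_scaleC_right scaleC_scaleC scaleC_minus_left
        scaleC_diff_right)
  also have "\<dots> = x * x + t *\<^sub>R 1"
    unfolding \<open>c * c = _\<close> by (simp add: scaleC_minus_left scaleC_of_real)
  finally show ?thesis .
qed

section \<open>Square roots and the norm of a self-adjoint element\<close>

text \<open>The recursion \<open>(n + 1) g\<^sub>n\<^sub>+\<^sub>1 = (n - 1/2) g\<^sub>n\<close> for the absolute values \<open>g\<^sub>n\<close>, \<open>n \<ge> 1\<close>, makes
\<open>g\<^sub>n = 2(n g\<^sub>n - (n + 1) g\<^sub>n\<^sub>+\<^sub>1)\<close> telescope. Summability at the boundary of the disc of convergence is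
what allows \<open>\<parallel>a\<parallel> = 1\<close> in the square root below.\<close>
lemma summable_half_gbinomial: "summable (\<lambda>n. \<bar>(1/2::real) gchoose n\<bar>)"
proof -
  define g where "g n = \<bar>(1/2::real) gchoose n\<bar>" for n
  have tele: "g (Suc n) = 2 * (real (Suc n) * g (Suc n) - real (Suc (Suc n)) * g (Suc (Suc n)))" for n
  proof -
    have "real (Suc (Suc n)) * ((1/2) gchoose Suc (Suc n))
      = (1/2 - real (Suc n)) * ((1/2) gchoose Suc n)"
      using gbinomial_mult_1[of "1/2::real" "Suc n"] by (simp add: algebra_simps)
    then have "\<bar>real (Suc (Suc n)) * ((1/2) gchoose Suc (Suc n))\<bar>
      = \<bar>(1/2 - real (Suc n)) * ((1/2) gchoose Suc n)\<bar>" by simp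
    then have "real (Suc (Suc n)) * g (Suc (Suc n)) = (real (Suc n) - 1/2) * g (Suc n)"
      unfolding abs_mult g_def by simp
    then show ?thesis by (simp add: algebra_simps)
  qed
  have "(\<Sum>i<n. g (Suc i)) = 2 * (g 1 - real (Suc n) * g (Suc n))" for n
    by (induction n) (use tele in \<open>simp_all add: algebra_simps\<close>)
  moreover have "0 \<le> g n" for n by (simp add: g_def)
  ultimately have "summable (\<lambda>n. g (Suc n))"
    by (intro summableI_nonneg_bounded[where x = "2 * g 1"]) auto
  then show ?thesis unfolding g_def by (rule summable_Suc_iff[THEN iffD1])
qed

lemma gbinomial_one: "((1::real) gchoose n) = (if n \<le> 1 then 1 else 0)"
proof -
  have "((1::real) gchoose n) = of_nat (1 choose n)" using binomial_gbinomial[of 1 n, where 'a=real] by simp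
  then show ?thesis by (cases n) (auto simp: binomial_eq_0)
qed

text \<open>The root is the binomial series of \<open>(1 - a)\<^bsup>1/2\<^esup>\<close>; its square is computed by the Cauchy
product and the Vandermonde identity. Being a limit of real polynomials in \<open>a\<close>, it is self-adjoint and
commutes with whatever commutes with \<open>a\<close>.\<close>
lemma sqrt_one_minus:
  fixes a :: "'a::unital_cstar_algebra"
  assumes "norm a \<le> 1" and sa: "star a = a"
  obtains y where "star y = y" "y * y = 1 - a" "\<And>d. a * d = d * a \<Longrightarrow> y * d = d * y"
proof -
  define c where "c n = (1/2::real) gchoose n" for n
  define t where "t n = c n *\<^sub>R (- a) ^ n" for n
  have sn: "summable (\<lambda>n. norm (t n))"
  proof (rule summable_comparison_test'[OF summable_half_gbinomial, of 0])
    fix n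
    have "norm ((- a) ^ n) \<le> 1"
      using norm_power_ineq[of "- a" n] assms(1)
      by (smt (verit) norm_ge_zero norm_minus_cancel power_le_one)
    then show "norm (norm (t n)) \<le> \<bar>1 / 2 gchoose n\<bar>"
      unfolding t_def c_def by (simp add: mult_left_le)
  qed
  then have s: "summable t" by (rule summable_norm_cancel)
  define y where "y = suminf t"
  have st: "star (t n) = t n" for n
    by (simp add: t_def star_scaleR star_power star_minus sa)
  have "star y = y"
    unfolding y_def using bounded_linear.suminf[OF bounded_linear_star s] by (simp add: st)
  moreover have "y * y = 1 - a"
  proof -
    have conv: "(\<Sum>i\<le>k. t i * t (k - i)) = (if k \<le> 1 then 1 else 0) *\<^sub>R (- a) ^ k" for k
    proof -
      have "(\<Sum>i\<le>k. t i * t (k - i)) = (\<Sum>i\<le>k. (c i * c (k - i)) *\<^sub>R (- a) ^ k)"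
        by (intro sum.cong refl) (simp add: t_def flip: power_add)
      also have "\<dots> = (\<Sum>i\<le>k. c i * c (k - i)) *\<^sub>R (- a) ^ k"
        by (simp add: scaleR_sum_left)
      also have "(\<Sum>i\<le>k. c i * c (k - i)) = (1 gchoose k)"
        using gbinomial_Vandermonde[of "1/2::real" "1/2" k] by (simp add: c_def atMost_atLeast0)
      finally show ?thesis by (simp add: gbinomial_one)
    qed
    have "y * y = (\<Sum>k. (if k \<le> 1 then 1 else 0) *\<^sub>R (- a) ^ k)"
      unfolding y_def using Cauchy_product[OF sn sn] by (simp add: conv)
    also have "\<dots> = (\<Sum>k\<in>{0,1}. (if k \<le> 1 then 1 else 0) *\<^sub>R (- a) ^ k)"
      by (rule suminf_finite) auto
    finally show ?thesis by simp
  qed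
  moreover have "y * d = d * y" if d: "a * d = d * a" for d
  proof -
    have "(- a) ^ n * d = d * (- a) ^ n" for n
      using d by (intro power_commuting_commutes) simp
    then have "t n * d = d * t n" for n by (simp add: t_def)
    then show ?thesis
      unfolding y_def using suminf_mult[OF s, of d] suminf_mult2[OF s, of d] by simp
  qed
  ultimately show ?thesis using that by blast
qed

lemma norm_square_sa: "star b = b \<Longrightarrow> norm (b * b) = (norm (b::'a::unital_cstar_algebra))\<^sup>2"
  using cstar_identity[of b] by simp

text \<open>For commuting \<open>b\<close> and \<open>w\<close> the right side is \<open>\<parallel>v\<parallel>\<^sup>2\<close> with \<open>v = b + iw\<close>, and \<open>b\<close> is the real part of \<open>v\<close>.\<close>
lemma norm_square_le_sum:
  fixes b w :: "'a::unital_cstar_algebra"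
  assumes "star b = b" "star w = w" "b * w = w * b"
  shows "(norm b)\<^sup>2 \<le> norm (b * b + w * w)"
proof -
  define v where "v = b + \<i> *\<^sub>C w"
  have st: "star v = b - \<i> *\<^sub>C w"
    by (simp add: v_def star_add star_scaleC assms scaleC_minus_left)
  have "star v * v = b * b + w * w"
    unfolding st unfolding v_def
    by (simp add: algebra_simps mult_scaleC_left mult_scaleC_right scaleC_scaleC assms(3)
        scaleC_minus_left scaleC_diff_right)
  then have nv: "(norm v)\<^sup>2 = norm (b * b + w * w)" by (metis cstar_identity)
  have "2 *\<^sub>R b = v + star v" unfolding st unfolding v_def by (simp add: scaleR_2)
  then have "2 * norm b \<le> norm v + norm (star v)"
    by (metis norm_scaleR norm_triangle_ineq abs_numeral)
  then have "norm b \<le> norm v" by simp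
  then show ?thesis unfolding nv[symmetric] by (intro power_mono) auto
qed

text \<open>Let \<open>u\<close> be the inverse of \<open>1 - b\<^sup>2\<close> and \<open>0 < c < 1\<close> with \<open>\<parallel>cu\<parallel> \<le> 1\<close>. Both \<open>1 - b\<^sup>2 = y\<^sup>2\<close> and
\<open>1 - cu = r\<^sup>2\<close> have self-adjoint square roots, and everything in sight commutes, so
\<open>(yr)\<^sup>2 = (1 - b\<^sup>2)(1 - cu) = 1 - b\<^sup>2 - c\<close>. Thus \<open>b\<^sup>2 + (yr)\<^sup>2 = 1 - c\<close> and \<open>\<parallel>b\<parallel>\<^sup>2 \<le> 1 - c\<close>.\<close>
lemma norm_less_one_of_unit:
  fixes b :: "'a::unital_cstar_algebra"
  assumes sa: "star b = b" and b1: "norm b \<le> 1" and unit: "bi_unit (1 - b * b)"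
  shows "norm b < 1"
proof -
  from unit obtain u where u: "(1 - b * b) * u = 1" "u * (1 - b * b) = 1"
    unfolding bi_unit_def by blast
  have bb: "star (b * b) = b * b" by (simp add: star_mult sa)
  have inv_comm: "u * d = d * u" if "(1 - b * b) * d = d * (1 - b * b)" for d
    by (metis that u mult.assoc mult_1_left mult_1_right)
  have usa: "star u = u"
  proof -
    have "star u * (1 - b * b) = 1"
      using arg_cong[OF u(1), of star] by (simp add: star_mult star_diff sa)
    then show ?thesis by (metis u(1) mult.assoc mult_1_left mult_1_right)
  qed
  have "norm (b * b) \<le> 1" using b1 norm_square_sa[OF sa] by (simp add: power_le_one)
  from sqrt_one_minus[OF this bb] obtain y
    where y: "star y = y" "y * y = 1 - b * b" "\<And>d. b * b * d = d * (b * b) \<Longrightarrow> y * d = d * y"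
    by blast
  define c where "c = 1 / (norm u + 1)"
  have c: "0 < c" "c < 1"
    using u by (auto simp: c_def field_simps add_pos_nonneg)
  have "norm (c *\<^sub>R u) \<le> 1"
    using norm_ge_zero[of u] by (simp add: c_def divide_simps del: norm_ge_zero)
  moreover have "star (c *\<^sub>R u) = c *\<^sub>R u" by (simp add: star_scaleR usa)
  ultimately obtain r where r: "star r = r" "r * r = 1 - c *\<^sub>R u"
      "\<And>d. c *\<^sub>R u * d = d * c *\<^sub>R u \<Longrightarrow> r * d = d * r"
    using sqrt_one_minus by metis
  have ub: "u * b = b * u" by (rule inv_comm) (simp add: algebra_simps)
  have yb: "y * b = b * y" by (rule y(3)) (simp add: mult.assoc)
  have yu: "u * y = y * u" by (rule inv_comm) (simp add: y(2)[symmetric] mult.assoc)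
  have rb: "r * b = b * r" by (rule r(3)) (simp add: ub)
  have ry: "r * y = y * r" by (rule r(3)) (simp add: yu)
  have "star (y * r) = y * r" by (simp add: star_mult y r ry)
  moreover have "b * (y * r) = (y * r) * b" by (metis mult.assoc yb rb)
  ultimately have "(norm b)\<^sup>2 \<le> norm (b * b + (y * r) * (y * r))"
    using norm_square_le_sum sa by blast
  also have "(y * r) * (y * r) = (y * y) * (r * r)" by (metis mult.assoc ry)
  also have "\<dots> = (1 - b * b) - c *\<^sub>R 1" using u by (simp add: y r right_diff_distrib)
  finally have "(norm b)\<^sup>2 \<le> norm ((1 - c) *\<^sub>R (1::'a))" by (simp add: scaleR_left_diff_distrib)
  with c have "(norm b)\<^sup>2 < 1" by simp
  then show ?thesis using power_less_one_iff[of "norm b" 2] by simp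
qed

text \<open>Otherwise, after normalising \<open>\<parallel>k\<parallel> = 1\<close>, the product \<open>(1 - k)(1 + k) = 1 - k\<^sup>2\<close> would be a unit and
hence \<open>\<parallel>k\<parallel> < 1\<close>.\<close>
lemma norm_in_spectrum:
  fixes k :: "'a::unital_cstar_algebra"
  assumes sa: "star k = k"
  shows "of_real (norm k) \<in> cstar_spectrum k \<or> of_real (- norm k) \<in> cstar_spectrum k"
proof (rule ccontr)
  assume "\<not> ?thesis"
  then have u: "bi_unit (norm k *\<^sub>R 1 - k)" "bi_unit (- norm k *\<^sub>R 1 - k)"
    unfolding spectrum_of_real_iff by auto
  have k: "norm k \<noteq> 0" using u(1) by (auto simp: bi_unit_def)
  define b where "b = inverse (norm k) *\<^sub>R k"
  have "bi_unit (norm k *\<^sub>R (1 - b))" "bi_unit ((- norm k) *\<^sub>R (1 + b))"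
    using u k by (simp_all add: b_def scaleR_right_diff_distrib scaleR_right_distrib)
  then have "bi_unit ((1 - b) * (1 + b))"
    using k by (intro bi_unit_mult) (simp_all only: bi_unit_scaleR neg_equal_0_iff_equal simp_thms)
  then have "bi_unit (1 - b * b)" by (simp add: algebra_simps)
  moreover have "star b = b" by (simp add: b_def star_scaleR sa)
  moreover have "norm b = 1" using k by (simp add: b_def)
  ultimately show False using norm_less_one_of_unit[of b] by simp
qed

section \<open>The positive cone\<close>

lemma positive_selfadjoint: "cstar_positive a \<Longrightarrow> star a = a"
  by (simp add: cstar_positive_def)

lemma positive_spectrum_nonneg:
  "cstar_positive a \<Longrightarrow> complex_of_real x \<in> cstar_spectrum a \<Longrightarrow> 0 \<le> x"
  unfolding cstar_positive_def by auto

lemma positiveI: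
  assumes sa: "star a = a" and "\<And>x. complex_of_real x \<in> cstar_spectrum a \<Longrightarrow> 0 \<le> x"
  shows "cstar_positive a"
  unfolding cstar_positive_def
proof (intro conjI subsetI)
  fix z assume z: "z \<in> cstar_spectrum a"
  then have "Im z = 0" by (rule selfadjoint_spectrum_real[OF sa])
  then have "z = of_real (Re z)" by (simp add: complex_eq_iff)
  with assms(2) z show "z \<in> \<real>\<^sub>\<ge>\<^sub>0"
    by (metis nonneg_Reals_of_real_iff)
qed (rule sa)

text \<open>With \<open>k = t - a\<close>, the number \<open>\<parallel>k\<parallel>\<close> or \<open>-\<parallel>k\<parallel>\<close> is in the spectrum of \<open>k\<close>, so \<open>t - \<parallel>k\<parallel>\<close> or \<open>t + \<parallel>k\<parallel>\<close>
is in that of \<open>a\<close>. The first must be nonnegative, the second at most \<open>\<parallel>a\<parallel> \<le> t\<close>. Together with the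
converse below this replaces the spectral definition of positivity by a condition on norms, which is
visibly stable under sums and limits.\<close>
lemma positive_norm_diff_le:
  assumes a: "cstar_positive a" and t: "norm a \<le> t"
  shows "norm (t *\<^sub>R 1 - a) \<le> t"
proof -
  define k where "k = t *\<^sub>R 1 - a"
  have "star k = k" using a by (simp add: k_def star_diff star_scaleR positive_selfadjoint)
  then consider "of_real (norm k) \<in> cstar_spectrum k" | "of_real (- norm k) \<in> cstar_spectrum k"
    using norm_in_spectrum by blast
  then show ?thesis
  proof cases
    case 1
    then have "of_real (t - norm k) \<in> cstar_spectrum a" by (simp add: k_def spectrum_reflect)
    then have "0 \<le> t - norm k" by (rule positive_spectrum_nonneg[OF a])
    then show ?thesis by (simp add: k_def)
  next
    case 2
    then have "of_real (t + norm k) \<in> cstar_spectrum a" by (simp add: k_def spectrum_reflect)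
    then have "cmod (of_real (t + norm k)) \<le> norm a" by (rule spectrum_norm_le)
    then have "norm k \<le> 0" using t by (smt (verit) norm_of_real)
    then show ?thesis using t norm_ge_zero[of a] unfolding k_def by linarith
  qed
qed

lemma positiveI_norm:
  assumes sa: "star a = a" and n: "norm (t *\<^sub>R 1 - a) \<le> t"
  shows "cstar_positive a"
proof (rule positiveI[OF sa])
  fix x assume "complex_of_real x \<in> cstar_spectrum a"
  then have "of_real (t - x) \<in> cstar_spectrum (t *\<^sub>R 1 - a)" by (simp add: spectrum_reflect)
  then have "cmod (of_real (t - x)) \<le> t" using spectrum_norm_le n by (meson order_trans)
  then have "\<bar>t - x\<bar> \<le> t" by (simp only: norm_of_real)
  then show "0 \<le> x" by simp
qed

lemma positive_zero: "cstar_positive 0"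
  by (rule positiveI_norm[where t = 0]) auto

lemma positive_one: "cstar_positive 1"
  by (rule positiveI_norm[where t = 1]) auto

lemma positive_add:
  assumes "cstar_positive a" "cstar_positive b"
  shows "cstar_positive (a + b)"
proof (rule positiveI_norm)
  show "star (a + b) = a + b" using assms by (simp add: star_add positive_selfadjoint)
  have "(norm a + norm b) *\<^sub>R 1 - (a + b) = (norm a *\<^sub>R 1 - a) + (norm b *\<^sub>R 1 - b)"
    by (simp add: scaleR_left_distrib)
  then show "norm ((norm a + norm b) *\<^sub>R 1 - (a + b)) \<le> norm a + norm b"
    using positive_norm_diff_le[OF assms(1) order_refl] positive_norm_diff_le[OF assms(2) order_refl]
    by (metis add_mono norm_triangle_le)
qed

lemma positive_scaleR:
  assumes "cstar_positive a" "0 \<le> c"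
  shows "cstar_positive (c *\<^sub>R a)"
proof (rule positiveI_norm)
  show "star (c *\<^sub>R a) = c *\<^sub>R a" using assms by (simp add: star_scaleR positive_selfadjoint)
  have "(c * norm a) *\<^sub>R 1 - c *\<^sub>R a = c *\<^sub>R (norm a *\<^sub>R 1 - a)"
    by (simp add: scaleR_right_diff_distrib)
  then show "norm ((c * norm a) *\<^sub>R 1 - c *\<^sub>R a) \<le> c * norm a"
    using positive_norm_diff_le[OF assms(1) order_refl] assms(2) by (simp add: mult_left_mono)
qed

lemma closed_positive: "closed {a::'a::unital_cstar_algebra. cstar_positive a}"
proof -
  have "{a::'a. cstar_positive a} = {a. star a = a} \<inter> {a. norm (norm a *\<^sub>R 1 - a) \<le> norm a}"
    using positive_norm_diff_le positiveI_norm positive_selfadjoint by blast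
  moreover have "closed {a::'a. star a = a}"
    by (intro closed_Collect_eq continuous_intros bounded_linear.continuous_on[OF bounded_linear_star])
  moreover have "closed {a::'a. norm (norm a *\<^sub>R 1 - a) \<le> norm a}"
    by (intro closed_Collect_le continuous_intros)
  ultimately show ?thesis by (simp add: closed_Int)
qed

lemma positive_scaled_one_minus:
  assumes "star a = a" "norm a \<le> t" shows "cstar_positive (t *\<^sub>R 1 - a)"
  by (rule positiveI_norm[where t = t]) (use assms in \<open>auto simp: star_diff star_scaleR\<close>)

lemma norm_le_of_scaled_one_minus_positive:
  assumes a: "cstar_positive a" and ta: "cstar_positive (t *\<^sub>R 1 - a)" and t: "0 \<le> t"
  shows "norm a \<le> t"
proof -
  consider "of_real (norm a) \<in> cstar_spectrum a" | "of_real (- norm a) \<in> cstar_spectrum a"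
    using norm_in_spectrum a positive_selfadjoint by blast
  then show ?thesis
  proof cases
    case 1
    then have "of_real (t - norm a) \<in> cstar_spectrum (t *\<^sub>R 1 - a)" by (simp add: spectrum_reflect)
    then show ?thesis using positive_spectrum_nonneg[OF ta] by fastforce
  next
    case 2
    then have "0 \<le> - norm a" by (rule positive_spectrum_nonneg[OF a])
    with t show ?thesis by simp
  qed
qed

lemma positive_norm_mono:
  assumes a: "cstar_positive a" and ab: "a \<preceq> b"
  shows "norm a \<le> norm b"
proof (rule norm_le_of_scaled_one_minus_positive[OF a])
  have "star b = b"
    using a ab positive_selfadjoint[of "b - a"] positive_selfadjoint[of a]
    by (simp add: star_diff cstar_le_def)
  then have "cstar_positive ((norm b *\<^sub>R 1 - b) + (b - a))"
    using ab by (intro positive_add positive_scaled_one_minus) (auto simp: cstar_le_def)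
  then show "cstar_positive (norm b *\<^sub>R 1 - a)" by simp
qed simp

lemma square_positive:
  assumes sa: "star x = x" shows "cstar_positive (x * x)"
proof (rule positiveI)
  fix t assume "complex_of_real t \<in> cstar_spectrum (x * x)"
  then have "\<not> bi_unit (- (x * x + (- t) *\<^sub>R 1))" by (simp add: spectrum_of_real_iff)
  then show "0 \<le> t" using bi_unit_square_plus[OF sa, of "- t"] unfolding bi_unit_minus by force
qed (simp add: star_mult sa)

section \<open>Deriving the order from norms\<close>

text \<open>A positive unit \<open>Q\<close> has its spectrum bounded away from \<open>0\<close>, so \<open>Q - d\<close> is positive for some \<open>d > 0\<close>;
then \<open>P + (Q - d)\<close> is positive and does not have the spectral value \<open>-d\<close>.\<close>
lemma positive_add_bi_unit:
  assumes P: "cstar_positive P" and Q: "cstar_positive Q" and unit: "bi_unit Q"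
  shows "bi_unit (P + Q)"
proof -
  from unit obtain v where v: "Q * v = 1" "v * Q = 1" unfolding bi_unit_def by blast
  define d where "d = 1 / (norm v + 1)"
  have d: "0 < d" using norm_ge_zero[of v] by (simp add: d_def add_nonneg_pos del: norm_ge_zero)
  have "cstar_positive (Q - d *\<^sub>R 1)"
  proof (rule positiveI)
    fix z assume "complex_of_real z \<in> cstar_spectrum (Q - d *\<^sub>R 1)"
    then have "\<not> bi_unit ((z + d) *\<^sub>R 1 - Q)"
      by (simp add: spectrum_of_real_iff scaleR_left_distrib algebra_simps)
    moreover then have "0 \<le> z + d"
      using positive_spectrum_nonneg[OF Q, of "z + d"] spectrum_of_real_iff by blast
    moreover have "bi_unit ((z + d) *\<^sub>R 1 - Q)" if "0 \<le> z + d" "z < 0"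
    proof -
      have "(z + d) * norm v \<le> d * norm v" using that by (intro mult_right_mono) auto
      also have "d * norm v < 1"
        using norm_ge_zero[of v] by (simp add: d_def divide_simps del: norm_ge_zero)
      finally have "bi_unit (1 - (z + d) *\<^sub>R v)" using that by (intro bi_unit_one_minus) simp
      then have "bi_unit (- (Q * (1 - (z + d) *\<^sub>R v)))"
        using unit bi_unit_minus bi_unit_mult by blast
      then show ?thesis by (simp add: right_diff_distrib v)
    qed
    ultimately show "0 \<le> z" by force
  qed (simp add: star_diff star_scaleR positive_selfadjoint Q)
  then have pos: "cstar_positive (P + (Q - d *\<^sub>R 1))" using P by (rule positive_add[rotated])
  have "complex_of_real (- d) \<notin> cstar_spectrum (P + (Q - d *\<^sub>R 1))"
    using positive_spectrum_nonneg[OF pos] d by fastforce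
  then have "bi_unit (- (P + Q))" unfolding spectrum_of_real_iff by simp
  then show ?thesis by (simp only: bi_unit_minus)
qed

text \<open>For \<open>t > 0\<close> and \<open>g\<close> the inverse of \<open>h\<close>, the element \<open>hPh + t = h(P + t g\<^sup>2)h\<close> is a unit because
\<open>t g\<^sup>2\<close> is a positive unit.\<close>
lemma positive_conjugate:
  assumes P: "cstar_positive P" and g: "star g = g" and h: "star h = h"
    and gh: "g * h = 1" "h * g = 1"
  shows "cstar_positive (h * P * h)"
proof (rule positiveI)
  show "star (h * P * h) = h * P * h" by (simp add: star_mult h positive_selfadjoint P mult.assoc)
  fix z assume z: "complex_of_real z \<in> cstar_spectrum (h * P * h)"
  have gu: "bi_unit g" and hu: "bi_unit h" unfolding bi_unit_def using gh by blast+
  show "0 \<le> z"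
  proof (rule ccontr)
    assume "\<not> 0 \<le> z"
    then have t: "0 < - z" by simp
    have "bi_unit (P + (- z) *\<^sub>R (g * g))"
      using t g gu by (intro positive_add_bi_unit P positive_scaleR square_positive)
        (simp_all add: bi_unit_mult bi_unit_scaleR del: scaleR_minus_left)
    then have "bi_unit (- (h * (P + (- z) *\<^sub>R (g * g)) * h))"
      unfolding bi_unit_minus using hu by (intro bi_unit_mult)
    also have "- (h * (P + (- z) *\<^sub>R (g * g)) * h) = z *\<^sub>R ((h * g) * (g * h)) - h * P * h"
      by (simp add: algebra_simps)
    finally show False using z by (simp add: gh spectrum_of_real_iff)
  qed
qed

text \<open>With \<open>t = \<parallel>Q\<parallel> + e\<close> the element \<open>Q + e\<close> is \<open>t(1 - a)\<close> for \<open>a = (\<parallel>Q\<parallel> - Q)/t\<close>, and \<open>\<parallel>a\<parallel> \<le> 1\<close> by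
positivity of \<open>Q\<close>, so the binomial series gives its square root \<open>g\<close>; \<open>h\<close> is the inverse of \<open>g\<close>.\<close>
lemma sqrt_of_positive_plus:
  assumes Q: "cstar_positive Q" and e: "0 < e"
  obtains g h where "star g = g" "star h = h" "g * h = 1" "h * g = 1" "g * g = Q + e *\<^sub>R 1"
proof -
  define t where "t = norm Q + e"
  have t: "0 < t" using e by (simp add: t_def add_nonneg_pos)
  define a where "a = inverse t *\<^sub>R (norm Q *\<^sub>R 1 - Q)"
  have sa: "star a = a" using Q by (simp add: a_def star_scaleR star_diff positive_selfadjoint)
  have "norm (norm Q *\<^sub>R 1 - Q) \<le> t"
    using positive_norm_diff_le[OF Q order_refl] e by (simp add: t_def)
  then have "norm a \<le> 1"
    unfolding a_def norm_scaleR using t by (simp add: inverse_eq_divide divide_le_eq_1)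
  from sqrt_one_minus[OF this sa] obtain y where y: "star y = y" "y * y = 1 - a" by blast
  have ta: "t *\<^sub>R a = norm Q *\<^sub>R 1 - Q" using t by (simp add: a_def)
  define g where "g = sqrt t *\<^sub>R y"
  have "g * g = t *\<^sub>R (1 - a)" using t by (simp add: g_def y)
  also have "\<dots> = Q + e *\<^sub>R 1"
    by (simp add: scaleR_right_diff_distrib ta) (simp add: t_def scaleR_left_distrib)
  finally have gg: "g * g = Q + e *\<^sub>R 1" .
  have sg: "star g = g" by (simp add: g_def star_scaleR y)
  have "bi_unit (Q + e *\<^sub>R 1)"
    using e by (intro positive_add_bi_unit Q positive_scaleR positive_one)
      (auto simp: bi_unit_scaleR bi_unit_one)
  then obtain u where u: "g * g * u = 1" "u * (g * g) = 1"
    unfolding gg[symmetric] bi_unit_def by blast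
  define h where "h = g * u"
  have gh: "g * h = 1" using u by (simp add: h_def mult.assoc)
  have hg: "h * g = 1"
    by (metis gh mult.assoc mult_1_left mult_1_right u(2))
  have "star h * g = 1" using arg_cong[OF gh, of star] by (simp add: star_mult sg)
  then have "star h = h" by (metis gh mult.assoc mult_1_left mult_1_right)
  with gg sg gh hg show ?thesis using that by blast
qed

text \<open>Take \<open>h\<close> inverse to the square root \<open>g\<close> of \<open>Q + e\<close>. Then \<open>hQh = 1 - e h\<^sup>2 \<le> 1\<close>, so \<open>\<parallel>hPh\<parallel> \<le> 1\<close> and
\<open>1 - hPh\<close> is positive; conjugating by \<open>g\<close> gives \<open>P \<le> Q + e\<close>, and \<open>e\<close> tends to \<open>0\<close>.\<close>
lemma le_of_norm_conjugate_le:
  assumes P: "cstar_positive P" and Q: "cstar_positive Q"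
    and le: "\<And>h. star h = h \<Longrightarrow> norm (h * P * h) \<le> norm (h * Q * h)"
  shows "P \<preceq> Q"
proof -
  have eps: "cstar_positive (Q - P + e *\<^sub>R 1)" if e: "0 < e" for e :: real
  proof -
    from sqrt_of_positive_plus[OF Q e] obtain g h
      where g: "star g = g" and h: "star h = h" and gh: "g * h = 1" "h * g = 1"
        and gg: "g * g = Q + e *\<^sub>R 1" by blast
    have sandwich: "h * (g * g) * h = 1" by (metis gh mult.assoc mult_1_left)
    have "h * Q * h = h * (g * g - e *\<^sub>R 1) * h" by (simp add: gg)
    also have "\<dots> = 1 - e *\<^sub>R (h * h)"
      by (simp add: left_diff_distrib right_diff_distrib sandwich)
    finally have hQh: "1 *\<^sub>R 1 - h * Q * h = e *\<^sub>R (h * h)" by simp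
    have "norm (h * Q * h) \<le> 1"
    proof (rule norm_le_of_scaled_one_minus_positive)
      show "cstar_positive (h * Q * h)" using Q g h gh by (rule positive_conjugate)
      show "cstar_positive (1 *\<^sub>R 1 - h * Q * h)"
        unfolding hQh using e h by (intro positive_scaleR square_positive) auto
    qed simp
    then have "norm (h * P * h) \<le> 1" using le[OF h] by simp
    then have "cstar_positive (1 *\<^sub>R 1 - h * P * h)"
      by (intro positive_scaled_one_minus) (simp_all add: star_mult h positive_selfadjoint P mult.assoc)
    then have "cstar_positive (g * (1 *\<^sub>R 1 - h * P * h) * g)"
      using h g gh(2) gh(1) by (rule positive_conjugate)
    also have "g * (1 *\<^sub>R 1 - h * P * h) * g = g * g - (g * h) * P * (h * g)"
      by (simp add: left_diff_distrib right_diff_distrib mult.assoc)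
    also have "\<dots> = Q - P + e *\<^sub>R 1" by (simp add: gh gg)
    finally show ?thesis .
  qed
  have "(\<lambda>n. Q - P + inverse (real (Suc n)) *\<^sub>R 1) \<longlonglongrightarrow> Q - P + 0 *\<^sub>R 1"
    by (intro tendsto_intros LIMSEQ_inverse_real_of_nat)
  then have "Q - P + 0 *\<^sub>R 1 \<in> {a. cstar_positive a}"
    by (rule closed_sequentially[OF closed_positive, rotated]) (use eps in simp)
  then show ?thesis by (simp add: cstar_le_def)
qed

section \<open>Strong measurability and the Bochner integral\<close>

lemma simple_imp_strongly_measurable: "simple_function M s \<Longrightarrow> strongly_measurable M s"
  unfolding strongly_measurable_def by (rule exI[of _ "\<lambda>_. s"]) simp

lemma strongly_measurable_cong_AE:
  assumes f: "strongly_measurable M f" and eq: "AE w in M. f w = g w"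
  shows "strongly_measurable M g"
proof -
  from f obtain s where s: "\<And>i. simple_function M (s i)"
    and lim: "AE w in M. (\<lambda>i. s i w) \<longlonglongrightarrow> f w" unfolding strongly_measurable_def by blast
  from lim eq have "AE w in M. (\<lambda>i. s i w) \<longlonglongrightarrow> g w" by eventually_elim simp
  with s show ?thesis unfolding strongly_measurable_def by blast
qed

lemma strongly_measurable_compose2:
  assumes f: "strongly_measurable M f" and g: "strongly_measurable M g"
    and h: "\<And>xs ys x y. xs \<longlonglongrightarrow> x \<Longrightarrow> ys \<longlonglongrightarrow> y \<Longrightarrow> (\<lambda>i::nat. h (xs i) (ys i)) \<longlonglongrightarrow> h x y"
  shows "strongly_measurable M (\<lambda>w. h (f w) (g w))"
proof -
  from f obtain s where s: "\<And>i. simple_function M (s i)"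
    and ls: "AE w in M. (\<lambda>i. s i w) \<longlonglongrightarrow> f w" unfolding strongly_measurable_def by blast
  from g obtain t where t: "\<And>i. simple_function M (t i)"
    and lt: "AE w in M. (\<lambda>i. t i w) \<longlonglongrightarrow> g w" unfolding strongly_measurable_def by blast
  have "simple_function M (\<lambda>w. h (s i w) (t i w))" for i
    by (rule simple_function_compose2[OF s t])
  moreover from ls lt have "AE w in M. (\<lambda>i. h (s i w) (t i w)) \<longlonglongrightarrow> h (f w) (g w)"
    by eventually_elim (rule h)
  ultimately show ?thesis
    unfolding strongly_measurable_def by (intro exI[of _ "\<lambda>i w. h (s i w) (t i w)"]) blast
qed

lemma strongly_measurable_add:
  "strongly_measurable M f \<Longrightarrow> strongly_measurable M g \<Longrightarrow> strongly_measurable M (\<lambda>w. f w + g w)"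
  by (rule strongly_measurable_compose2) (auto intro: tendsto_add)

lemma strongly_measurable_diff:
  "strongly_measurable M f \<Longrightarrow> strongly_measurable M g \<Longrightarrow> strongly_measurable M (\<lambda>w. f w - g w)"
  by (rule strongly_measurable_compose2) (auto intro: tendsto_diff)

lemma strongly_measurable_diff_simple:
  "strongly_measurable M f \<Longrightarrow> simple_function M s \<Longrightarrow> strongly_measurable M (\<lambda>w. f w - s w)"
  by (rule strongly_measurable_diff[OF _ simple_imp_strongly_measurable])

lemma strongly_measurable_norm: "strongly_measurable M f \<Longrightarrow> strongly_measurable M (\<lambda>w. norm (f w))"
  by (rule strongly_measurable_compose2[where h = "\<lambda>x y. norm x"]) (auto intro: tendsto_norm)

lemma strongly_measurable_linear:
  assumes "bounded_linear L" "strongly_measurable M f"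
  shows "strongly_measurable M (\<lambda>w. L (f w))"
  using assms(2)
  by (rule strongly_measurable_compose2[OF _ assms(2), where h = "\<lambda>x y. L x"])
    (rule bounded_linear.tendsto[OF assms(1)])

text \<open>The norm of a strongly measurable function may fail to be Borel measurable on a null set when the
measure is not complete. Its Borel representative makes the integral of norms additive, which the lower integral
of arbitrary functions is not.\<close>
lemma strongly_measurable_norm_AE_borel:
  assumes "strongly_measurable M f"
  obtains u :: "'w \<Rightarrow> real"
  where "u \<in> borel_measurable M" "AE w in M. norm (f w) = u w"
proof -
  from strongly_measurable_norm[OF assms] obtain s :: "nat \<Rightarrow> 'w \<Rightarrow> real"
    where s: "\<And>i. simple_function M (s i)"
    and lim: "AE w in M. (\<lambda>i. s i w) \<longlonglongrightarrow> norm (f w)" unfolding strongly_measurable_def by blast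
  have "(\<lambda>w. lim (\<lambda>i. s i w)) \<in> borel_measurable M"
    by (intro borel_measurable_lim_metric borel_measurable_simple_function s)
  moreover from lim have "AE w in M. norm (f w) = lim (\<lambda>i. s i w)"
    by eventually_elim (simp add: limI)
  ultimately show ?thesis by (rule that)
qed

lemma nn_integral_norm_triangle:
  assumes f: "strongly_measurable M f" and g: "strongly_measurable M g"
    and h: "AE w in M. norm (h w) \<le> norm (f w) + norm (g w)"
  shows "(\<integral>\<^sup>+w. ennreal (norm (h w)) \<partial>M)
    \<le> (\<integral>\<^sup>+w. ennreal (norm (f w)) \<partial>M) + (\<integral>\<^sup>+w. ennreal (norm (g w)) \<partial>M)"
proof -
  obtain u where u[measurable]: "u \<in> borel_measurable M" and fu: "AE w in M. norm (f w) = u w"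
    using strongly_measurable_norm_AE_borel[OF f] by blast
  obtain v where v[measurable]: "v \<in> borel_measurable M" and gv: "AE w in M. norm (g w) = v w"
    using strongly_measurable_norm_AE_borel[OF g] by blast
  have "(\<integral>\<^sup>+w. ennreal (norm (h w)) \<partial>M) \<le> (\<integral>\<^sup>+w. ennreal (u w) + ennreal (v w) \<partial>M)"
    using h fu gv
  proof (intro nn_integral_mono_AE, eventually_elim)
    fix w assume a: "norm (h w) \<le> norm (f w) + norm (g w)" "norm (f w) = u w" "norm (g w) = v w"
    then have "0 \<le> u w" "0 \<le> v w" by (metis norm_ge_zero)+
    with a show "ennreal (norm (h w)) \<le> ennreal (u w) + ennreal (v w)"
      by (simp flip: ennreal_plus)
  qed
  also have "\<dots> = (\<integral>\<^sup>+w. ennreal (u w) \<partial>M) + (\<integral>\<^sup>+w. ennreal (v w) \<partial>M)"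
    by (rule nn_integral_add) auto
  also have "(\<integral>\<^sup>+w. ennreal (u w) \<partial>M) = (\<integral>\<^sup>+w. ennreal (norm (f w)) \<partial>M)"
    using fu by (intro nn_integral_cong_AE) auto
  also have "(\<integral>\<^sup>+w. ennreal (v w) \<partial>M) = (\<integral>\<^sup>+w. ennreal (norm (g w)) \<partial>M)"
    using gv by (intro nn_integral_cong_AE) auto
  finally show ?thesis .
qed

lemma nn_integral_norm_scale:
  assumes f: "strongly_measurable M f" and K: "0 \<le> K"
    and h: "AE w in M. norm (h w) \<le> K * norm (f w)"
  shows "(\<integral>\<^sup>+w. ennreal (norm (h w)) \<partial>M) \<le> ennreal K * (\<integral>\<^sup>+w. ennreal (norm (f w)) \<partial>M)"
proof -
  obtain u where u[measurable]: "u \<in> borel_measurable M" and fu: "AE w in M. norm (f w) = u w"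
    using strongly_measurable_norm_AE_borel[OF f] by blast
  have "(\<integral>\<^sup>+w. ennreal (norm (h w)) \<partial>M) \<le> (\<integral>\<^sup>+w. ennreal K * ennreal (u w) \<partial>M)"
    using h fu
  proof (intro nn_integral_mono_AE, eventually_elim)
    fix w assume a: "norm (h w) \<le> K * norm (f w)" "norm (f w) = u w"
    then have "ennreal (norm (h w)) \<le> ennreal (K * u w)" by (intro ennreal_leI) simp
    with K show "ennreal (norm (h w)) \<le> ennreal K * ennreal (u w)"
      by (simp add: ennreal_mult' )
  qed
  also have "\<dots> = ennreal K * (\<integral>\<^sup>+w. ennreal (u w) \<partial>M)" by (rule nn_integral_cmult) auto
  also have "(\<integral>\<^sup>+w. ennreal (u w) \<partial>M) = (\<integral>\<^sup>+w. ennreal (norm (f w)) \<partial>M)"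
    using fu by (intro nn_integral_cong_AE) auto
  finally show ?thesis .
qed

lemma has_strong_bochner_integralI:
  assumes "strongly_measurable M f"
    and "\<And>i::nat. Bochner_Integration.simple_bochner_integrable M (s i)"
    and "(\<lambda>i. \<integral>\<^sup>+w. ennreal (norm (f w - s i w)) \<partial>M) \<longlonglongrightarrow> 0"
    and "(\<lambda>i. Bochner_Integration.simple_bochner_integral M (s i)) \<longlonglongrightarrow> I"
  shows "has_strong_bochner_integral M f I"
  unfolding has_strong_bochner_integral_def by (intro conjI exI[of _ s] allI assms)

lemma has_strong_bochner_integralE:
  assumes "has_strong_bochner_integral M f I"
  obtains s where "strongly_measurable M f"
    and "\<And>i::nat. Bochner_Integration.simple_bochner_integrable M (s i)"
    and "\<And>i. simple_function M (s i)"
    and "(\<lambda>i. \<integral>\<^sup>+w. ennreal (norm (f w - s i w)) \<partial>M) \<longlonglongrightarrow> 0"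
    and "(\<lambda>i. Bochner_Integration.simple_bochner_integral M (s i)) \<longlonglongrightarrow> I"
proof -
  from assms obtain s where s: "strongly_measurable M f"
      "\<And>i::nat. Bochner_Integration.simple_bochner_integrable M (s i)"
      "(\<lambda>i. \<integral>\<^sup>+w. ennreal (norm (f w - s i w)) \<partial>M) \<longlonglongrightarrow> 0"
      "(\<lambda>i. Bochner_Integration.simple_bochner_integral M (s i)) \<longlonglongrightarrow> I"
    unfolding has_strong_bochner_integral_def by blast
  have "simple_function M (s i)" for i
    using s(2)[of i] by (rule Bochner_Integration.simple_bochner_integrable.cases)
  with s show ?thesis by (intro that[of s])
qed

lemma has_strong_bochner_integral_cong_AE:
  assumes f: "has_strong_bochner_integral M f I" and eq: "AE w in M. f w = g w"
  shows "has_strong_bochner_integral M g I"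
proof -
  have "(\<integral>\<^sup>+w. ennreal (norm (f w - s w)) \<partial>M) = (\<integral>\<^sup>+w. ennreal (norm (g w - s w)) \<partial>M)" for s
    using eq by (intro nn_integral_cong_AE) auto
  with f eq show ?thesis
    unfolding has_strong_bochner_integral_def using strongly_measurable_cong_AE by auto
qed

lemma has_strong_bochner_integral_add:
  assumes f: "has_strong_bochner_integral M f I" and g: "has_strong_bochner_integral M g J"
  shows "has_strong_bochner_integral M (\<lambda>w. f w + g w) (I + J)"
proof -
  from f obtain s where s: "strongly_measurable M f"
      "\<And>i. Bochner_Integration.simple_bochner_integrable M (s i)" "\<And>i. simple_function M (s i)"
      "(\<lambda>i. \<integral>\<^sup>+w. ennreal (norm (f w - s i w)) \<partial>M) \<longlonglongrightarrow> 0"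
      "(\<lambda>i. Bochner_Integration.simple_bochner_integral M (s i)) \<longlonglongrightarrow> I"
    by (rule has_strong_bochner_integralE) blast
  from g obtain t where t: "strongly_measurable M g"
      "\<And>i. Bochner_Integration.simple_bochner_integrable M (t i)" "\<And>i. simple_function M (t i)"
      "(\<lambda>i. \<integral>\<^sup>+w. ennreal (norm (g w - t i w)) \<partial>M) \<longlonglongrightarrow> 0"
      "(\<lambda>i. Bochner_Integration.simple_bochner_integral M (t i)) \<longlonglongrightarrow> J"
    by (rule has_strong_bochner_integralE) blast
  let ?st = "\<lambda>i w. s i w + t i w"
  have sbi: "Bochner_Integration.simple_bochner_integrable M (?st i)" for i
    by (rule simple_bochner_integrable_compose2[OF _ s(2) t(2)]) simp
  have lim: "(\<lambda>i. \<integral>\<^sup>+w. ennreal (norm (f w + g w - ?st i w)) \<partial>M) \<longlonglongrightarrow> 0"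
  proof (rule tendsto_sandwich[where f = "\<lambda>_. 0"])
    show "eventually (\<lambda>i. (\<integral>\<^sup>+w. ennreal (norm (f w + g w - ?st i w)) \<partial>M) \<le>
      (\<integral>\<^sup>+w. ennreal (norm (f w - s i w)) \<partial>M) + (\<integral>\<^sup>+w. ennreal (norm (g w - t i w)) \<partial>M)) sequentially"
    proof (intro always_eventually allI)
      fix i show "(\<integral>\<^sup>+w. ennreal (norm (f w + g w - ?st i w)) \<partial>M) \<le>
        (\<integral>\<^sup>+w. ennreal (norm (f w - s i w)) \<partial>M) + (\<integral>\<^sup>+w. ennreal (norm (g w - t i w)) \<partial>M)"
        by (rule nn_integral_norm_triangle[OF strongly_measurable_diff_simple[OF s(1) s(3)]
            strongly_measurable_diff_simple[OF t(1) t(3)]])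
          (rule AE_I2, rule norm_diff_triangle_ineq)
    qed
    show "(\<lambda>i. (\<integral>\<^sup>+w. ennreal (norm (f w - s i w)) \<partial>M) + (\<integral>\<^sup>+w. ennreal (norm (g w - t i w)) \<partial>M)) \<longlonglongrightarrow> 0"
      using tendsto_add[OF s(4) t(4)] by simp
  qed auto
  have int: "(\<lambda>i. Bochner_Integration.simple_bochner_integral M (?st i)) \<longlonglongrightarrow> I + J"
    using tendsto_add[OF s(5) t(5)] by (simp add: simple_bochner_integral_add s t)
  show ?thesis
    by (rule has_strong_bochner_integralI[OF strongly_measurable_add[OF s(1) t(1)] sbi lim int])
qed

lemma has_strong_bochner_integral_linear:
  assumes L: "bounded_linear L" and f: "has_strong_bochner_integral M f I"
  shows "has_strong_bochner_integral M (\<lambda>w. L (f w)) (L I)"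
proof -
  from f obtain s where s: "strongly_measurable M f"
      "\<And>i. Bochner_Integration.simple_bochner_integrable M (s i)" "\<And>i. simple_function M (s i)"
      "(\<lambda>i. \<integral>\<^sup>+w. ennreal (norm (f w - s i w)) \<partial>M) \<longlonglongrightarrow> 0"
      "(\<lambda>i. Bochner_Integration.simple_bochner_integral M (s i)) \<longlonglongrightarrow> I"
    by (rule has_strong_bochner_integralE) blast
  interpret bounded_linear L by (rule L)
  obtain K where K: "0 \<le> K" "\<And>x. norm (L x) \<le> K * norm x"
    using nonneg_bounded by (metis mult.commute)
  have sbi: "Bochner_Integration.simple_bochner_integrable M (\<lambda>w. L (s i w))" for i
    by (rule simple_bochner_integrable_compose2[where p = "\<lambda>x y. L x", OF _ s(2) s(2)]) simp
  have lim: "(\<lambda>i. \<integral>\<^sup>+w. ennreal (norm (L (f w) - L (s i w))) \<partial>M) \<longlonglongrightarrow> 0"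
  proof (rule tendsto_sandwich[where f = "\<lambda>_. 0"])
    show "eventually (\<lambda>i. (\<integral>\<^sup>+w. ennreal (norm (L (f w) - L (s i w))) \<partial>M) \<le>
      ennreal K * (\<integral>\<^sup>+w. ennreal (norm (f w - s i w)) \<partial>M)) sequentially"
    proof (rule always_eventually, rule allI)
      fix i show "(\<integral>\<^sup>+w. ennreal (norm (L (f w) - L (s i w))) \<partial>M) \<le>
        ennreal K * (\<integral>\<^sup>+w. ennreal (norm (f w - s i w)) \<partial>M)"
        by (rule nn_integral_norm_scale[OF strongly_measurable_diff_simple[OF s(1) s(3)] K(1)])
          (rule AE_I2, unfold diff[symmetric], rule K(2))
    qed
    show "(\<lambda>i. ennreal K * (\<integral>\<^sup>+w. ennreal (norm (f w - s i w)) \<partial>M)) \<longlonglongrightarrow> 0"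
      using ennreal_tendsto_cmult[OF _ s(4), of "ennreal K"] by simp
  qed auto
  have int: "(\<lambda>i. Bochner_Integration.simple_bochner_integral M (\<lambda>w. L (s i w))) \<longlonglongrightarrow> L I"
    using tendsto[OF s(5)] by (simp add: simple_bochner_integral_linear linear_axioms s)
  show ?thesis
    by (rule has_strong_bochner_integralI[OF strongly_measurable_linear[OF L s(1)] sbi lim int])
qed

text \<open>For approximating simple functions \<open>s\<close>, sublinearity and \<open>p(f w) = 0\<close> give
\<open>p(\<integral>s) \<le> \<integral>p(s) \<le> \<integral>\<parallel>f - s\<parallel>\<close>, which tends to \<open>0\<close>, while \<open>p\<close> is Lipschitz. With \<open>p\<close> the norm this
yields uniqueness of the integral, with \<open>p\<close> the distance to a closed cone that integration stays
in the cone.\<close>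
lemma sublinear_has_strong_bochner_integral_zero:
  fixes p :: "'b::real_normed_vector \<Rightarrow> real"
  assumes nonneg: "\<And>x. 0 \<le> p x" and le_norm: "\<And>x. p x \<le> norm x"
    and sub: "\<And>x y. p (x + y) \<le> p x + p y" and scale: "\<And>c x. 0 \<le> c \<Longrightarrow> p (c *\<^sub>R x) \<le> c * p x"
    and f: "has_strong_bochner_integral M f I" and zero: "AE w in M. p (f w) = 0"
  shows "p I = 0"
proof -
  from f obtain s where s: "strongly_measurable M f"
      "\<And>i. Bochner_Integration.simple_bochner_integrable M (s i)" "\<And>i. simple_function M (s i)"
      "(\<lambda>i. \<integral>\<^sup>+w. ennreal (norm (f w - s i w)) \<partial>M) \<longlonglongrightarrow> 0"
      "(\<lambda>i. Bochner_Integration.simple_bochner_integral M (s i)) \<longlonglongrightarrow> I"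
    by (rule has_strong_bochner_integralE) blast
  let ?SI = "Bochner_Integration.simple_bochner_integral M"
  have p0: "p 0 = 0" using nonneg[of 0] le_norm[of 0] by simp
  have p_sum: "p (sum h F) \<le> (\<Sum>y\<in>F. p (h y))" if "finite F" for h :: "'b \<Rightarrow> 'b" and F
    using that
  proof induction
    case (insert y F)
    then show ?case using sub[of "h y" "sum h F"] by simp
  qed (simp add: p0)
  have bound: "ennreal (p (?SI (s i))) \<le> (\<integral>\<^sup>+w. ennreal (norm (f w - s i w)) \<partial>M)" for i
  proof -
    have int: "Bochner_Integration.simple_bochner_integrable M (\<lambda>w. p (s i w))"
      by (rule simple_bochner_integrable_compose2[where p = "\<lambda>x y. p x", OF _ s(2) s(2)]) (rule p0)
    have "finite (s i ` space M)" using s(3) by (rule simple_functionD)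
    then have "p (?SI (s i)) \<le> (\<Sum>y\<in>s i ` space M. p (measure M {w \<in> space M. s i w = y} *\<^sub>R y))"
      unfolding simple_bochner_integral_def by (rule p_sum)
    also have "\<dots> \<le> (\<Sum>y\<in>s i ` space M. measure M {w \<in> space M. s i w = y} *\<^sub>R p y)"
      by (intro sum_mono) (simp add: scale)
    also have "\<dots> = ?SI (\<lambda>w. p (s i w))"
      using int s(3) by (intro simple_bochner_integral_partition[symmetric]) auto
    finally have "ennreal (p (?SI (s i))) \<le> ennreal (?SI (\<lambda>w. p (s i w)))" by (rule ennreal_leI)
    also have "\<dots> = (\<integral>\<^sup>+w. ennreal (p (s i w)) \<partial>M)"
      using int nonneg by (rule simple_bochner_integral_eq_nn_integral)
    also have "\<dots> \<le> (\<integral>\<^sup>+w. ennreal (norm (f w - s i w)) \<partial>M)"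
      using zero
    proof (intro nn_integral_mono_AE, eventually_elim)
      fix w assume "p (f w) = 0"
      then have "p (s i w) \<le> norm (f w - s i w)"
        using sub[of "f w" "s i w - f w"] le_norm[of "s i w - f w"] by (simp add: norm_minus_commute)
      then show "ennreal (p (s i w)) \<le> ennreal (norm (f w - s i w))" by (rule ennreal_leI)
    qed
    finally show ?thesis .
  qed
  have lipschitz: "\<bar>p x - p y\<bar> \<le> norm (x - y)" for x y
    using sub[of y "x - y"] sub[of x "y - x"] le_norm[of "x - y"] le_norm[of "y - x"]
    by (simp add: norm_minus_commute)
  have "(\<lambda>i. p (?SI (s i)) - p I) \<longlonglongrightarrow> 0"
    by (rule tendsto_0_le[where K = 1, OF LIM_zero[OF s(5)]]) (simp add: lipschitz)
  then have "(\<lambda>i. p (?SI (s i))) \<longlonglongrightarrow> p I" by (rule LIM_zero_cancel)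
  then have "(\<lambda>i. ennreal (p (?SI (s i)))) \<longlonglongrightarrow> ennreal (p I)" by (rule tendsto_ennrealI)
  then have "ennreal (p I) \<le> 0" by (rule LIMSEQ_le[OF _ s(4)]) (use bound in blast)
  then show ?thesis using nonneg[of I] by (simp add: ennreal_eq_0_iff)
qed

lemma has_strong_bochner_integral_unique:
  assumes "has_strong_bochner_integral M f I" "has_strong_bochner_integral M f J"
  shows "I = J"
proof -
  have "has_strong_bochner_integral M (\<lambda>w. f w + - f w) (I + - J)"
    by (rule has_strong_bochner_integral_add[OF assms(1)
        has_strong_bochner_integral_linear[OF bounded_linear_minus[OF bounded_linear_ident] assms(2)]])
  then have "norm (I + - J) = 0"
    by (rule sublinear_has_strong_bochner_integral_zero[where p = norm, rotated 4])
      (simp_all add: norm_triangle_ineq)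
  then show ?thesis by simp
qed

lemma strong_bochner_integral_eq:
  "has_strong_bochner_integral M f I \<Longrightarrow> strong_bochner_integral M f = I"
  unfolding strong_bochner_integral_def by (blast intro: has_strong_bochner_integral_unique)

lemma has_strong_bochner_integral_integral:
  "strong_bochner_integrable M f \<Longrightarrow> has_strong_bochner_integral M f (strong_bochner_integral M f)"
  unfolding strong_bochner_integrable_def using strong_bochner_integral_eq by metis

lemma has_strong_bochner_integral_in_closed_cone:
  fixes P :: "'b::real_normed_vector set"
  assumes P: "closed P" and zero: "0 \<in> P"
    and add: "\<And>x y. x \<in> P \<Longrightarrow> y \<in> P \<Longrightarrow> x + y \<in> P"
    and scale: "\<And>c x. 0 \<le> c \<Longrightarrow> x \<in> P \<Longrightarrow> c *\<^sub>R x \<in> P"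
    and f: "has_strong_bochner_integral M f I" and fP: "AE w in M. f w \<in> P"
  shows "I \<in> P"
proof -
  have ne: "P \<noteq> {}" using zero by blast
  have approx: "\<exists>a\<in>P. dist x a < infdist x P + e" if "0 < e" for x e
    using cInf_lessD[of "dist x ` P" "infdist x P + e"] that ne by (auto simp: infdist_notempty)
  have "infdist I P = 0"
  proof (rule sublinear_has_strong_bochner_integral_zero[OF _ _ _ _ f])
    show "0 \<le> infdist x P" for x by (rule infdist_nonneg)
    show "infdist x P \<le> norm x" for x using infdist_le[OF zero, of x] by simp
    show "infdist (x + y) P \<le> infdist x P + infdist y P" for x y
    proof (rule field_le_epsilon)
      fix e :: real assume "0 < e"
      then have "0 < e / 2" by simp
      from approx[OF this, of x] approx[OF this, of y] obtain a b
        where ab: "a \<in> P" "dist x a < infdist x P + e / 2" "b \<in> P" "dist y b < infdist y P + e / 2"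
        by blast
      have "infdist (x + y) P \<le> dist (x + y) (a + b)" using ab add by (intro infdist_le) auto
      also have "\<dots> \<le> dist x a + dist y b" by (simp add: dist_norm norm_diff_triangle_ineq)
      finally show "infdist (x + y) P \<le> infdist x P + infdist y P + e" using ab by simp
    qed
    show "infdist (c *\<^sub>R x) P \<le> c * infdist x P" if c: "0 \<le> c" for c x
    proof (cases "c = 0")
      case False
      with c have c: "0 < c" by simp
      show ?thesis
      proof (rule field_le_epsilon)
        fix e :: real assume "0 < e"
        then have "0 < e / c" using c by simp
        from approx[OF this, of x] obtain a where a: "a \<in> P" "dist x a < infdist x P + e / c" by blast
        have "infdist (c *\<^sub>R x) P \<le> dist (c *\<^sub>R x) (c *\<^sub>R a)" using a c scale by (intro infdist_le) auto
        also have "\<dots> = c * dist x a" using c by (simp add: dist_norm flip: scaleR_right_diff_distrib)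
        also have "\<dots> \<le> c * (infdist x P + e / c)" using a c by (intro mult_left_mono) auto
        finally show "infdist (c *\<^sub>R x) P \<le> c * infdist x P + e" using c by (simp add: distrib_left)
      qed
    qed (simp add: zero)
    show "AE w in M. infdist (f w) P = 0" using fP by eventually_elim simp
  qed
  then show ?thesis using in_closed_iff_infdist_zero[OF P ne] by blast
qed

lemma nn_integral_norm_simple_finite:
  assumes "Bochner_Integration.simple_bochner_integrable M s"
  shows "(\<integral>\<^sup>+w. ennreal (norm (s w)) \<partial>M) < \<infinity>"
    and "ennreal (norm (Bochner_Integration.simple_bochner_integral M s))
      \<le> (\<integral>\<^sup>+w. ennreal (norm (s w)) \<partial>M)"
proof -
  have "Bochner_Integration.simple_bochner_integrable M (\<lambda>w. norm (s w))"
    by (rule simple_bochner_integrable_compose2[where p = "\<lambda>x y. norm x", OF _ assms assms]) simp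
  then have eq: "(\<integral>\<^sup>+w. ennreal (norm (s w)) \<partial>M)
      = ennreal (Bochner_Integration.simple_bochner_integral M (\<lambda>w. norm (s w)))"
    by (intro simple_bochner_integral_eq_nn_integral[symmetric]) auto
  show "(\<integral>\<^sup>+w. ennreal (norm (s w)) \<partial>M) < \<infinity>" unfolding eq by simp
  show "ennreal (norm (Bochner_Integration.simple_bochner_integral M s))
      \<le> (\<integral>\<^sup>+w. ennreal (norm (s w)) \<partial>M)"
    unfolding eq by (intro ennreal_leI simple_bochner_integral_norm_bound assms)
qed

lemma has_strong_bochner_integral_finite:
  assumes "has_strong_bochner_integral M f I"
  shows "(\<integral>\<^sup>+w. ennreal (norm (f w)) \<partial>M) < \<infinity>"
proof -
  from assms obtain s where s: "strongly_measurable M f"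
      "\<And>i. Bochner_Integration.simple_bochner_integrable M (s i)" "\<And>i. simple_function M (s i)"
      "(\<lambda>i. \<integral>\<^sup>+w. ennreal (norm (f w - s i w)) \<partial>M) \<longlonglongrightarrow> 0"
    by (rule has_strong_bochner_integralE) blast
  have "eventually (\<lambda>i. (\<integral>\<^sup>+w. ennreal (norm (f w - s i w)) \<partial>M) < 1) sequentially"
    using s(4) by (rule order_tendstoD) simp
  then obtain i where i: "(\<integral>\<^sup>+w. ennreal (norm (f w - s i w)) \<partial>M) < 1"
    by (auto simp: eventually_sequentially)
  have "norm (f w) \<le> norm (f w - s i w) + norm (s i w)" for w
    using norm_triangle_ineq[of "f w - s i w" "s i w"] by simp
  then have "(\<integral>\<^sup>+w. ennreal (norm (f w)) \<partial>M)
      \<le> (\<integral>\<^sup>+w. ennreal (norm (f w - s i w)) \<partial>M) + (\<integral>\<^sup>+w. ennreal (norm (s i w)) \<partial>M)"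
    by (intro nn_integral_norm_triangle[OF strongly_measurable_diff_simple[OF s(1) s(3)]
        simple_imp_strongly_measurable[OF s(3)]] AE_I2)
  also have "\<dots> < \<infinity>"
    using i nn_integral_norm_simple_finite(1)[OF s(2)] by (auto intro: less_trans)
  finally show ?thesis .
qed

text \<open>Cutting the simple functions that converge to \<open>f\<close> off where their norm exceeds \<open>2\<parallel>f\<parallel>\<close> keeps the
limit and makes dominated convergence applicable. The cut-off functions have integrable norm, hence
support of finite measure, even if the original ones do not.\<close>
lemma strong_bochner_integrableI:
  fixes f :: "'w \<Rightarrow> 'b::banach"
  assumes f: "strongly_measurable M f" and fin: "(\<integral>\<^sup>+w. ennreal (norm (f w)) \<partial>M) < \<infinity>"
  shows "strong_bochner_integrable M f"
proof -
  from f obtain s where s: "\<And>i::nat. simple_function M (s i)"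
    and lim: "AE w in M. (\<lambda>i. s i w) \<longlonglongrightarrow> f w" unfolding strongly_measurable_def by blast
  obtain g where g[measurable]: "g \<in> borel_measurable M" and fg: "AE w in M. norm (f w) = g w"
    using strongly_measurable_norm_AE_borel[OF f] by blast
  have fin_g: "(\<integral>\<^sup>+w. ennreal (g w) \<partial>M) < \<infinity>"
  proof -
    have "(\<integral>\<^sup>+w. ennreal (g w) \<partial>M) = (\<integral>\<^sup>+w. ennreal (norm (f w)) \<partial>M)"
      using fg by (intro nn_integral_cong_AE) auto
    with fin show ?thesis by simp
  qed
  define t where "t i w = (if norm (s i w) \<le> 2 * g w then s i w else 0)" for i w
  have t: "simple_function M (t i)" for i
  proof -
    have [measurable]: "(\<lambda>w. norm (s i w)) \<in> borel_measurable M"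
      by (intro borel_measurable_simple_function simple_function_compose1[OF s])
    show ?thesis
      unfolding t_def by (intro simple_function_If s simple_function_const) measurable
  qed
  have t_le: "AE w in M. norm (t i w) \<le> 2 * g w" for i
    using fg by eventually_elim (simp add: t_def, metis norm_ge_zero)
  have fin_t: "(\<integral>\<^sup>+w. ennreal (norm (t i w)) \<partial>M) < \<infinity>" for i
  proof -
    have "AE w in M. norm (t i w) \<le> 2 * norm (f w)" using t_le[of i] fg by eventually_elim simp
    then have "(\<integral>\<^sup>+w. ennreal (norm (t i w)) \<partial>M) \<le> ennreal 2 * (\<integral>\<^sup>+w. ennreal (norm (f w)) \<partial>M)"
      by (rule nn_integral_norm_scale[OF f, rotated]) simp
    also have "\<dots> < \<infinity>" using fin by (simp add: ennreal_mult_less_top)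
    finally show ?thesis .
  qed
  have ti: "Bochner_Integration.simple_bochner_integrable M (t i)" for i
    using t fin_t by (rule simple_bochner_integrableI_bounded)
  have lim_t: "AE w in M. (\<lambda>i. t i w) \<longlonglongrightarrow> f w"
    using lim fg
  proof eventually_elim
    fix w assume l: "(\<lambda>i. s i w) \<longlonglongrightarrow> f w" and e: "norm (f w) = g w"
    show "(\<lambda>i. t i w) \<longlonglongrightarrow> f w"
    proof (cases "f w = 0")
      case True
      with e have "t i w = 0" for i by (auto simp: t_def)
      with True show ?thesis by simp
    next
      case False
      then have "norm (f w) < 2 * g w" using e by (metis mult_2 less_add_same_cancel1 zero_less_norm_iff)
      then have "eventually (\<lambda>i. norm (s i w) < 2 * g w) sequentially"
        using tendsto_norm[OF l] by (rule order_tendstoD(2)[rotated])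
      then have "eventually (\<lambda>i. s i w = t i w) sequentially"
        by eventually_elim (simp add: t_def)
      with l show ?thesis by (rule Lim_transform_eventually)
    qed
  qed
  have "\<exists>u. u \<in> borel_measurable M \<and> (AE w in M. norm (f w - t i w) = u w)" for i
    using strongly_measurable_norm_AE_borel[OF
        strongly_measurable_diff[OF f simple_imp_strongly_measurable[OF t]], of i] by blast
  then obtain u where u[measurable]: "\<And>i. u i \<in> borel_measurable M"
    and fu: "\<And>i. AE w in M. norm (f w - t i w) = u i w" by metis
  have "(\<lambda>i. \<integral>\<^sup>+w. ennreal (u i w) \<partial>M) \<longlonglongrightarrow> (\<integral>\<^sup>+w. 0 \<partial>M)"
  proof (rule nn_integral_dominated_convergence[where w = "\<lambda>w. ennreal 3 * ennreal (g w)"])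
    show "AE w in M. ennreal (u i w) \<le> ennreal 3 * ennreal (g w)" for i
      using fu[of i] fg t_le[of i]
    proof eventually_elim
      fix w assume "norm (f w - t i w) = u i w" "norm (f w) = g w" "norm (t i w) \<le> 2 * g w"
      then have "u i w \<le> 3 * g w" using norm_triangle_ineq4[of "f w" "t i w"] by simp
      then have "ennreal (u i w) \<le> ennreal (3 * g w)" by (rule ennreal_leI)
      also have "\<dots> = ennreal 3 * ennreal (g w)" by (rule ennreal_mult') simp
      finally show "ennreal (u i w) \<le> ennreal 3 * ennreal (g w)" .
    qed
    show "(\<integral>\<^sup>+w. ennreal 3 * ennreal (g w) \<partial>M) < \<infinity>"
      using fin_g by (simp add: nn_integral_cmult ennreal_mult_less_top)
    have "AE w in M. \<forall>i. norm (f w - t i w) = u i w" using fu by (simp add: AE_all_countable)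
    with lim_t show "AE w in M. (\<lambda>i. ennreal (u i w)) \<longlonglongrightarrow> 0"
    proof eventually_elim
      fix w assume l: "(\<lambda>i. t i w) \<longlonglongrightarrow> f w" and e: "\<forall>i. norm (f w - t i w) = u i w"
      have "(\<lambda>i. norm (f w - t i w)) \<longlonglongrightarrow> norm (f w - f w)" by (intro tendsto_intros l)
      then have "(\<lambda>i. u i w) \<longlonglongrightarrow> 0" using e by simp
      then show "(\<lambda>i. ennreal (u i w)) \<longlonglongrightarrow> 0" using tendsto_ennrealI by fastforce
    qed
  qed simp_all
  moreover have "(\<integral>\<^sup>+w. ennreal (norm (f w - t i w)) \<partial>M) = (\<integral>\<^sup>+w. ennreal (u i w) \<partial>M)" for i
    using fu[of i] by (intro nn_integral_cong_AE) auto
  ultimately have conv: "(\<lambda>i. \<integral>\<^sup>+w. ennreal (norm (f w - t i w)) \<partial>M) \<longlonglongrightarrow> 0" by simp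
  let ?SI = "Bochner_Integration.simple_bochner_integral M"
  have dist_le: "ennreal (norm (?SI (t i) - ?SI (t j)))
      \<le> (\<integral>\<^sup>+w. ennreal (norm (f w - t i w)) \<partial>M) + (\<integral>\<^sup>+w. ennreal (norm (f w - t j w)) \<partial>M)" for i j
  proof -
    have "Bochner_Integration.simple_bochner_integrable M (\<lambda>w. t i w - t j w)"
      by (rule simple_bochner_integrable_compose2[OF _ ti ti]) simp
    then have "ennreal (norm (?SI (\<lambda>w. t i w - t j w))) \<le> (\<integral>\<^sup>+w. ennreal (norm (t i w - t j w)) \<partial>M)"
      by (rule nn_integral_norm_simple_finite)
    also have "\<dots> \<le> (\<integral>\<^sup>+w. ennreal (norm (f w - t i w)) \<partial>M) + (\<integral>\<^sup>+w. ennreal (norm (f w - t j w)) \<partial>M)"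
    proof (rule nn_integral_norm_triangle[OF strongly_measurable_diff_simple[OF f t]
          strongly_measurable_diff_simple[OF f t]], rule AE_I2)
      fix w show "norm (t i w - t j w) \<le> norm (f w - t i w) + norm (f w - t j w)"
        using norm_triangle_ineq4[of "f w - t j w" "f w - t i w"] by simp
    qed
    finally show ?thesis by (simp add: simple_bochner_integral_diff ti)
  qed
  have "Cauchy (\<lambda>i. ?SI (t i))"
  proof (rule metric_CauchyI)
    fix e :: real assume "0 < e"
    then have "eventually (\<lambda>i. (\<integral>\<^sup>+w. ennreal (norm (f w - t i w)) \<partial>M) < ennreal (e / 2)) sequentially"
      using conv by (intro order_tendstoD(2)) (auto simp: ennreal_zero_less_divide)
    then obtain N where N: "\<And>i. N \<le> i \<Longrightarrow> (\<integral>\<^sup>+w. ennreal (norm (f w - t i w)) \<partial>M) < ennreal (e / 2)"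
      unfolding eventually_sequentially by blast
    have "dist (?SI (t i)) (?SI (t j)) < e" if "N \<le> i" "N \<le> j" for i j
    proof -
      have "ennreal (norm (?SI (t i) - ?SI (t j))) < ennreal (e / 2) + ennreal (e / 2)"
        using dist_le add_strict_mono[OF N[OF that(1)] N[OF that(2)]] by (rule le_less_trans)
      also have "\<dots> = ennreal e" using \<open>0 < e\<close> by (simp flip: ennreal_plus)
      finally show ?thesis by (simp add: dist_norm ennreal_less_iff)
    qed
    then show "\<exists>N. \<forall>i\<ge>N. \<forall>j\<ge>N. dist (?SI (t i)) (?SI (t j)) < e" by blast
  qed
  then obtain I where "(\<lambda>i. ?SI (t i)) \<longlonglongrightarrow> I" using Cauchy_convergent convergentD by blast
  then have "has_strong_bochner_integral M f I" by (rule has_strong_bochner_integralI[OF f ti conv])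
  then show ?thesis unfolding strong_bochner_integrable_def by blast
qed

section \<open>Hilbert modules\<close>

context hilbert_cstar_module
begin

lemma ip_add_right: "ip x (y + z) = ip x y + ip x z"
  by (metis ip_add_left ip_star star_add)

lemma ip_scaleC_left: "ip (c *\<^sub>C x) y = c *\<^sub>C ip x y"
proof -
  have "ip (c *\<^sub>C x) y = ip (act (c *\<^sub>C 1) x) y" by (simp add: act_scaleC_left act_one)
  also have "\<dots> = c *\<^sub>C ip x y" by (simp add: ip_act_left mult_scaleC_left)
  finally show ?thesis .
qed

lemma ip_scaleC_right: "ip x (c *\<^sub>C y) = cnj c *\<^sub>C ip x y"
  by (metis ip_scaleC_left ip_star star_scaleC)

lemma ip_minus_left: "ip (- x) y = - ip x y"
  using ip_scaleC_left[of "-1" x y] by (simp add: scaleC_minus_left)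

lemma ip_minus_right: "ip x (- y) = - ip x y"
  using ip_scaleC_right[of x "-1" y] by (simp add: scaleC_minus_left)

lemma ip_diff_left: "ip (x - y) z = ip x z - ip y z"
  using ip_add_left[of x "- y" z] by (simp add: ip_minus_left)

lemma ip_diff_right: "ip x (y - z) = ip x y - ip x z"
  using ip_add_right[of x y "- z"] by (simp add: ip_minus_right)

lemma ip_scaleR_left: "ip (r *\<^sub>R x) y = r *\<^sub>R ip x y"
  by (simp add: scaleR_scaleC ip_scaleC_left)

lemma ip_scaleR_right: "ip x (r *\<^sub>R y) = r *\<^sub>R ip x y"
  by (simp add: scaleR_scaleC ip_scaleC_right)

lemma ip_act_right: "ip x (act a y) = ip x y * star a"
  by (metis ip_act_left ip_star star_mult)

lemma norm_ip_self: "norm (ip x x) = (norm x)\<^sup>2"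
  by (simp add: norm_eq_ip)

lemma parallelogram: "ip (x + y) (x + y) + ip (x - y) (x - y) = 2 *\<^sub>R ip x x + 2 *\<^sub>R ip y y"
  by (simp add: ip_add_left ip_add_right ip_diff_left ip_diff_right scaleR_2)

lemma polarization:
  "4 *\<^sub>R ip x y = (ip (x + y) (x + y) - ip (x - y) (x - y))
     + \<i> *\<^sub>C (ip (x + \<i> *\<^sub>C y) (x + \<i> *\<^sub>C y) - ip (x - \<i> *\<^sub>C y) (x - \<i> *\<^sub>C y))"
proof -
  have 1: "ip (x + y) (x + y) - ip (x - y) (x - y) = 2 *\<^sub>R ip x y + 2 *\<^sub>R ip y x" for y
    by (simp add: ip_add_left ip_add_right ip_diff_left ip_diff_right scaleR_2)
  have r: "\<i> *\<^sub>C (r *\<^sub>R a) = r *\<^sub>R (\<i> *\<^sub>C a)" for r and a :: 'a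
    by (simp add: scaleR_scaleC scaleC_scaleC mult.commute)
  have "4 *\<^sub>R ip x y = 2 *\<^sub>R ip x y + 2 *\<^sub>R ip x y" by (simp flip: scaleR_left_distrib)
  then show ?thesis
    unfolding 1 by (simp add: ip_scaleC_left ip_scaleC_right scaleC_add_right scaleC_diff_right r scaleC_scaleC
        scaleC_minus_left scaleC_minus_right)
qed

text \<open>Polarization on unit vectors gives this weak form of the Cauchy-Schwarz inequality, whose purpose is
the continuity of the inner product.\<close>
lemma norm_ip_le: "norm (ip x y) \<le> 4 * (norm x * norm y)"
proof -
  have unit: "norm (ip u v) \<le> 4" if u: "norm u = 1" and v: "norm v = 1" for u v
  proof -
    have le: "norm (ip z z) \<le> 4" if "norm z \<le> 2" for z
      unfolding norm_ip_self using power_mono[OF that, of 2] by simp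
    have "norm (\<i> *\<^sub>C v) = 1" using v by (simp add: norm_scaleC)
    then have z: "norm (u + v) \<le> 2" "norm (u - v) \<le> 2"
        "norm (u + \<i> *\<^sub>C v) \<le> 2" "norm (u - \<i> *\<^sub>C v) \<le> 2"
      using u v norm_triangle_ineq[of u v] norm_triangle_ineq4[of u v]
        norm_triangle_ineq[of u "\<i> *\<^sub>C v"] norm_triangle_ineq4[of u "\<i> *\<^sub>C v"] by simp_all
    have "4 * norm (ip u v) = norm (4 *\<^sub>R ip u v)" by simp
    also have "\<dots> \<le> norm (ip (u + v) (u + v) - ip (u - v) (u - v))
        + norm (ip (u + \<i> *\<^sub>C v) (u + \<i> *\<^sub>C v) - ip (u - \<i> *\<^sub>C v) (u - \<i> *\<^sub>C v))"
      unfolding polarization by (rule norm_triangle_le) (simp add: norm_scaleC)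
    also have "\<dots> \<le> (4 + 4) + (4 + 4)"
      by (intro add_mono order_trans[OF norm_triangle_ineq4] le z)
    finally show ?thesis by simp
  qed
  show ?thesis
  proof (cases "x = 0 \<or> y = 0")
    case True
    then have "ip x y = 0" using ip_scaleR_left[of 0] ip_scaleR_right[of _ 0] by auto
    then show ?thesis by simp
  next
    case False
    then have "norm (ip (inverse (norm x) *\<^sub>R x) (inverse (norm y) *\<^sub>R y)) \<le> 4"
      by (intro unit) auto
    with False show ?thesis by (simp add: ip_scaleR_left ip_scaleR_right field_simps)
  qed
qed

lemma bounded_bilinear_ip: "bounded_bilinear ip"
  by unfold_locales
    (auto simp: ip_add_left ip_add_right ip_scaleR_left ip_scaleR_right mult.assoc
      intro!: exI[of _ 4] order_trans[OF norm_ip_le])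

lemma strongly_measurable_ip:
  assumes "strongly_measurable M f" "strongly_measurable M g"
  shows "strongly_measurable M (\<lambda>w. ip (f w) (g w))"
  using assms by (rule strongly_measurable_compose2) (rule bounded_bilinear.tendsto[OF bounded_bilinear_ip])

text \<open>The existence of an adjoint forces compatibility with the module action, since
\<open>\<langle>T(ax), y\<rangle> = a\<langle>x, Sy\<rangle> = \<langle>a(Tx), y\<rangle>\<close> for all \<open>y\<close>.\<close>
lemma adjointable_act:
  assumes "T \<in> adjointable_operators ip" shows "T (act a x) = act a (T x)"
proof -
  from assms obtain S where S: "\<And>x y. ip (T x) y = ip x (S y)" unfolding adjointable_operators_def by blast
  have "ip (T (act a x) - act a (T x)) y = 0" for y
    by (simp add: ip_diff_left S ip_act_left)
  then show ?thesis using ip_definite by fastforce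
qed

lemma has_integral_ip_positive:
  assumes "has_strong_bochner_integral M (\<lambda>w. ip (f w) (f w)) I"
  shows "cstar_positive I"
proof -
  have "I \<in> {a. cstar_positive a}"
    by (rule has_strong_bochner_integral_in_closed_cone[OF closed_positive _ _ _ assms])
      (auto simp: positive_zero positive_add positive_scaleR ip_positive)
  then show ?thesis by simp
qed

lemma has_integral_ip_act:
  assumes f: "has_strong_bochner_integral M (\<lambda>w. ip (T w x) (T w x)) I"
    and T: "\<And>w. w \<in> space M \<Longrightarrow> T w \<in> adjointable_operators ip"
  shows "has_strong_bochner_integral M (\<lambda>w. ip (T w (act a x)) (T w (act a x))) (a * I * star a)"
proof -
  have "bounded_linear (\<lambda>b. a * b * star a)"
    by (intro bounded_linear_intros bounded_linear_ident)
  then have "has_strong_bochner_integral M (\<lambda>w. a * ip (T w x) (T w x) * star a) (a * I * star a)"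
    using f by (rule has_strong_bochner_integral_linear)
  then show ?thesis
    by (rule has_strong_bochner_integral_cong_AE)
      (simp add: adjointable_act[OF T] ip_act_left ip_act_right mult.assoc)
qed

text \<open>The parallelogram law exhibits \<open>2\<langle>f, f\<rangle> + 2\<langle>g, g\<rangle> - \<langle>f + g, f + g\<rangle>\<close> as the square
\<open>\<langle>f - g, f - g\<rangle>\<close>, so its integral is positive and the norm is monotone on positive elements.\<close>
lemma norm_integral_ip_add_le:
  assumes f: "has_strong_bochner_integral M (\<lambda>w. ip (f w) (f w)) I"
    and g: "has_strong_bochner_integral M (\<lambda>w. ip (g w) (g w)) J"
    and h: "has_strong_bochner_integral M (\<lambda>w. ip (f w + g w) (f w + g w)) H"
  shows "norm H \<le> 2 * norm I + 2 * norm J"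
proof -
  have "has_strong_bochner_integral M
      (\<lambda>w. (2 *\<^sub>R ip (f w) (f w) + 2 *\<^sub>R ip (g w) (g w)) + - ip (f w + g w) (f w + g w))
      ((2 *\<^sub>R I + 2 *\<^sub>R J) + - H)"
    by (rule has_strong_bochner_integral_add[OF has_strong_bochner_integral_add[OF
          has_strong_bochner_integral_linear[OF bounded_linear_scaleR_right f]
          has_strong_bochner_integral_linear[OF bounded_linear_scaleR_right g]]
          has_strong_bochner_integral_linear[OF bounded_linear_minus[OF bounded_linear_ident] h]])
  moreover have "(2 *\<^sub>R ip x x + 2 *\<^sub>R ip y y) + - ip (x + y) (x + y) = ip (x - y) (x - y)" for x y
    by (simp flip: parallelogram)
  ultimately have "cstar_positive ((2 *\<^sub>R I + 2 *\<^sub>R J) + - H)"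
    by (simp only: has_integral_ip_positive)
  then have "norm H \<le> norm (2 *\<^sub>R I + 2 *\<^sub>R J)"
    by (intro positive_norm_mono has_integral_ip_positive[OF h]) (simp add: cstar_le_def)
  also have "\<dots> \<le> 2 * norm I + 2 * norm J" by (rule norm_triangle_le) simp
  finally show ?thesis .
qed

lemma integrable_ip_diff:
  assumes f: "strongly_measurable M f" "strong_bochner_integrable M (\<lambda>w. ip (f w) (f w))"
    and g: "strongly_measurable M g" "strong_bochner_integrable M (\<lambda>w. ip (g w) (g w))"
  shows "strong_bochner_integrable M (\<lambda>w. ip (f w - g w) (f w - g w))"
proof (rule strong_bochner_integrableI)
  show "strongly_measurable M (\<lambda>w. ip (f w - g w) (f w - g w))"
    by (intro strongly_measurable_ip strongly_measurable_diff f g)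
  have le: "norm (ip (x - y) (x - y)) \<le> norm (2 *\<^sub>R ip x x) + norm (2 *\<^sub>R ip y y)" for x y
  proof -
    have "(norm (x - y))\<^sup>2 \<le> (norm x + norm y)\<^sup>2" by (intro power_mono norm_triangle_ineq4) simp
    also have "\<dots> \<le> 2 * (norm x)\<^sup>2 + 2 * (norm y)\<^sup>2"
      using sum_squares_bound[of "norm x" "norm y"] by (simp add: power2_sum)
    finally show ?thesis by (simp add: norm_ip_self)
  qed
  have two: "has_strong_bochner_integral M (\<lambda>w. 2 *\<^sub>R ip (h w) (h w)) (2 *\<^sub>R strong_bochner_integral M (\<lambda>w. ip (h w) (h w)))"
    if "strong_bochner_integrable M (\<lambda>w. ip (h w) (h w))" for h
    by (rule has_strong_bochner_integral_linear[OF bounded_linear_scaleR_right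
          has_strong_bochner_integral_integral[OF that]])
  have "strongly_measurable M (\<lambda>w. 2 *\<^sub>R ip (f w) (f w))" "strongly_measurable M (\<lambda>w. 2 *\<^sub>R ip (g w) (g w))"
    using two[OF f(2)] two[OF g(2)] by (auto simp: has_strong_bochner_integral_def)
  then have "(\<integral>\<^sup>+w. ennreal (norm (ip (f w - g w) (f w - g w))) \<partial>M)
    \<le> (\<integral>\<^sup>+w. ennreal (norm (2 *\<^sub>R ip (f w) (f w))) \<partial>M) + (\<integral>\<^sup>+w. ennreal (norm (2 *\<^sub>R ip (g w) (g w))) \<partial>M)"
    by (rule nn_integral_norm_triangle) (rule AE_I2, rule le)
  also have "\<dots> < \<infinity>"
    using has_strong_bochner_integral_finite[OF two[OF f(2)]]
      has_strong_bochner_integral_finite[OF two[OF g(2)]] by simp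
  finally show "(\<integral>\<^sup>+w. ennreal (norm (ip (f w - g w) (f w - g w))) \<partial>M) < \<infinity>" .
qed

section \<open>Frames and norms\<close>

text \<open>Replacing \<open>x\<close> by \<open>hx\<close> with \<open>h\<close> self-adjoint conjugates both \<open>\<langle>x, x\<rangle>\<close> and the integral by \<open>h\<close>. The
scalar hypotheses at all points \<open>hx\<close> are therefore the hypothesis of \<open>le_of_norm_conjugate_le\<close>, once
with the integral on the larger side and once on the smaller.\<close>
lemma frame_boundsI_norm:
  assumes R: "measurable_adjointable_family M ip R" and C: "0 < C" and D: "0 < D"
    and int: "\<And>x. strong_bochner_integrable M (\<lambda>w. ip (R w x) (R w x))"
    and lower: "\<And>x. C * (norm x)\<^sup>2 \<le> norm (strong_bochner_integral M (\<lambda>w. ip (R w x) (R w x)))"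
    and upper: "\<And>x. norm (strong_bochner_integral M (\<lambda>w. ip (R w x) (R w x))) \<le> D * (norm x)\<^sup>2"
  shows "continuous_operator_frame_with_bounds M ip R C D"
proof -
  define F where "F x = strong_bochner_integral M (\<lambda>w. ip (R w x) (R w x))" for x
  have F: "has_strong_bochner_integral M (\<lambda>w. ip (R w x) (R w x)) (F x)" for x
    unfolding F_def using int by (rule has_strong_bochner_integral_integral)
  have Fpos: "cstar_positive (F x)" for x using F by (rule has_integral_ip_positive)
  have Fact: "h * F x * h = F (act h x)" if "star h = h" for h x
  proof -
    have "has_strong_bochner_integral M (\<lambda>w. ip (R w (act h x)) (R w (act h x))) (h * F x * star h)"
      using R by (intro has_integral_ip_act F) (auto simp: measurable_adjointable_family_def)
    then have "F (act h x) = h * F x * star h" unfolding F_def by (rule strong_bochner_integral_eq)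
    then show ?thesis by (simp add: that)
  qed
  have norm_act: "norm (h * (c *\<^sub>R ip x x) * h) = c * (norm (act h x))\<^sup>2"
    if "star h = h" "0 < c" for h c x
    using that by (simp add: ip_act_left ip_act_right mult.assoc flip: norm_ip_self)
  have "C *\<^sub>R ip x x \<preceq> F x" for x
  proof (rule le_of_norm_conjugate_le)
    show "cstar_positive (C *\<^sub>R ip x x)" using C by (intro positive_scaleR ip_positive) simp
    show "norm (h * (C *\<^sub>R ip x x) * h) \<le> norm (h * F x * h)" if "star h = h" for h
      unfolding norm_act[OF that C] Fact[OF that] by (rule lower[folded F_def])
  qed (rule Fpos)
  moreover have "F x \<preceq> D *\<^sub>R ip x x" for x
  proof (rule le_of_norm_conjugate_le)
    show "cstar_positive (D *\<^sub>R ip x x)" using D by (intro positive_scaleR ip_positive) simp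
    show "norm (h * F x * h) \<le> norm (h * (D *\<^sub>R ip x x) * h)" if "star h = h" for h
      unfolding norm_act[OF that D] Fact[OF that] by (rule upper[folded F_def])
  qed (rule Fpos)
  ultimately show ?thesis
    using R C D int unfolding continuous_operator_frame_with_bounds_def F_def by blast
qed

lemma frame_norm_bounds:
  assumes "continuous_operator_frame_with_bounds M ip T A B"
  shows "A * (norm x)\<^sup>2 \<le> norm (strong_bochner_integral M (\<lambda>w. ip (T w x) (T w x)))"
    and "norm (strong_bochner_integral M (\<lambda>w. ip (T w x) (T w x))) \<le> B * (norm x)\<^sup>2"
proof -
  define I where "I = strong_bochner_integral M (\<lambda>w. ip (T w x) (T w x))"
  have AB: "0 < A" "0 < B" and int: "strong_bochner_integrable M (\<lambda>w. ip (T w x) (T w x))"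
    and le: "A *\<^sub>R ip x x \<preceq> I" "I \<preceq> B *\<^sub>R ip x x"
    using assms unfolding continuous_operator_frame_with_bounds_def I_def by blast+
  have "cstar_positive (A *\<^sub>R ip x x)" using AB by (intro positive_scaleR ip_positive) simp
  then have "norm (A *\<^sub>R ip x x) \<le> norm I" using le(1) by (rule positive_norm_mono)
  then show "A * (norm x)\<^sup>2 \<le> norm (strong_bochner_integral M (\<lambda>w. ip (T w x) (T w x)))"
    using AB by (simp add: norm_ip_self I_def)
  have "cstar_positive I"
    unfolding I_def using has_strong_bochner_integral_integral[OF int] by (rule has_integral_ip_positive)
  then have "norm I \<le> norm (B *\<^sub>R ip x x)" using le(2) by (rule positive_norm_mono)
  then show "norm (strong_bochner_integral M (\<lambda>w. ip (T w x) (T w x))) \<le> B * (norm x)\<^sup>2"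
    using AB by (simp add: norm_ip_self I_def)
qed

end

theorem theorem3p2:
  fixes act :: "'a::unital_cstar_algebra \<Rightarrow> 'h::complex_banach \<Rightarrow> 'h"
    and ip :: "'h \<Rightarrow> 'h \<Rightarrow> 'a"
    and M :: "'w measure"
    and T R :: "'w \<Rightarrow> 'h \<Rightarrow> 'h"
    and A B :: real
  assumes "hilbert_cstar_module act ip"
    and "continuous_operator_frame_with_bounds M ip T A B"
    and "measurable_adjointable_family M ip R"
  shows "continuous_operator_frame M ip R \<longleftrightarrow>
    (\<exists>K>0. \<forall>x.
       strong_bochner_integrable M (\<lambda>w. ip (T w x - R w x) (T w x - R w x)) \<and>
       strong_bochner_integrable M (\<lambda>w. ip (T w x) (T w x)) \<and>
       strong_bochner_integrable M (\<lambda>w. ip (R w x) (R w x)) \<and>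
       norm (strong_bochner_integral M (\<lambda>w. ip (T w x - R w x) (T w x - R w x)))
         \<le> K * min (norm (strong_bochner_integral M (\<lambda>w. ip (T w x) (T w x))))
                   (norm (strong_bochner_integral M (\<lambda>w. ip (R w x) (R w x)))))"
    (is "_ \<longleftrightarrow> ?rhs")
proof -
  interpret hilbert_cstar_module act ip by (rule assms(1))
  define F where "F S x = strong_bochner_integral M (\<lambda>w. ip (S w x) (S w x))"
    for S :: "'w \<Rightarrow> 'h \<Rightarrow> 'h" and x
  define D where "D w x = T w x - R w x" for w x
  have AB: "0 < A" "0 < B"
    and T_int: "\<And>x. strong_bochner_integrable M (\<lambda>w. ip (T w x) (T w x))"
    and T_meas: "\<And>x. strongly_measurable M (\<lambda>w. T w x)"
    using assms(2)
    unfolding continuous_operator_frame_with_bounds_def measurable_adjointable_family_def by blast+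
  have R_meas: "\<And>x. strongly_measurable M (\<lambda>w. R w x)"
    using assms(3) unfolding measurable_adjointable_family_def by blast
  have T_low: "A * (norm x)\<^sup>2 \<le> norm (F T x)" and T_up: "norm (F T x) \<le> B * (norm x)\<^sup>2" for x
    using frame_norm_bounds[OF assms(2), of x] unfolding F_def by blast+
  have has_F: "has_strong_bochner_integral M (\<lambda>w. ip (S w x) (S w x)) (F S x)"
    if "\<And>y. strong_bochner_integrable M (\<lambda>w. ip (S w y) (S w y))" for S x
    unfolding F_def using that by (rule has_strong_bochner_integral_integral)
  have min_iff: "a \<le> K * min b c \<longleftrightarrow> a \<le> K * b \<and> a \<le> K * c" if "0 < K" for a b c K :: real
    using that by (simp add: min_mult_distrib_left)
  have rhs: "?rhs \<longleftrightarrow> (\<exists>K>0. \<forall>x. strong_bochner_integrable M (\<lambda>w. ip (D w x) (D w x)) \<and>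
      strong_bochner_integrable M (\<lambda>w. ip (R w x) (R w x)) \<and>
      norm (F D x) \<le> K * norm (F T x) \<and> norm (F D x) \<le> K * norm (F R x))"
    unfolding D_def F_def by (simp add: T_int min_iff cong: conj_cong)
  show ?thesis unfolding rhs
  proof
    assume "continuous_operator_frame M ip R"
    then obtain C E where R: "continuous_operator_frame_with_bounds M ip R C E"
      unfolding continuous_operator_frame_def by blast
    then have CE: "0 < C" "0 < E"
      and R_int: "\<And>x. strong_bochner_integrable M (\<lambda>w. ip (R w x) (R w x))"
      unfolding continuous_operator_frame_with_bounds_def by blast+
    have R_low: "C * (norm x)\<^sup>2 \<le> norm (F R x)" and R_up: "norm (F R x) \<le> E * (norm x)\<^sup>2" for x
      using frame_norm_bounds[OF R, of x] unfolding F_def by blast+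
    have D_int: "strong_bochner_integrable M (\<lambda>w. ip (D w x) (D w x))" for x
      unfolding D_def by (intro integrable_ip_diff T_meas R_meas T_int R_int)
    \<comment> \<open>\<open>(2B + 2E)\<parallel>x\<parallel>\<^sup>2\<close> bounds the integral for \<open>T - R\<close>; the lower bounds \<open>A\<close> and \<open>C\<close>
      turn it into multiples of the integrals for \<open>T\<close> and \<open>R\<close>\<close>
    define K where "K = max ((2 * B + 2 * E) / A) ((2 * B + 2 * E) / C)"
    have D_up: "norm (F D x) \<le> (2 * B + 2 * E) * (norm x)\<^sup>2" for x
    proof -
      have "has_strong_bochner_integral M (\<lambda>w. ip (- R w x) (- R w x)) (F R x)"
        using has_F[of R, OF R_int] by (simp add: ip_minus_left ip_minus_right)
      then have "norm (F D x) \<le> 2 * norm (F T x) + 2 * norm (F R x)"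
        by (rule norm_integral_ip_add_le[OF has_F[of T, OF T_int]]) (use has_F[of D, OF D_int] in \<open>simp add: D_def\<close>)
      then show ?thesis using T_up[of x] R_up[of x] by (simp add: distrib_right)
    qed
    have K_le: "norm (F D x) \<le> K * norm (F S x)"
      if c: "0 < c" "(2 * B + 2 * E) / c \<le> K" and low: "c * (norm x)\<^sup>2 \<le> norm (F S x)" for c S x
    proof -
      have "norm (F D x) \<le> ((2 * B + 2 * E) / c) * (c * (norm x)\<^sup>2)"
        using D_up[of x] c by simp
      also have "\<dots> \<le> K * norm (F S x)"
        using c AB CE by (intro mult_mono low) (auto intro: order_trans[rotated])
      finally show ?thesis .
    qed
    have "0 < K" using AB CE by (simp add: K_def less_max_iff_disj)
    moreover have "norm (F D x) \<le> K * norm (F T x)" "norm (F D x) \<le> K * norm (F R x)" for x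
      using K_le[OF AB(1) _ T_low] K_le[OF CE(1) _ R_low] by (simp_all add: K_def)
    ultimately show "\<exists>K>0. \<forall>x. strong_bochner_integrable M (\<lambda>w. ip (D w x) (D w x)) \<and>
      strong_bochner_integrable M (\<lambda>w. ip (R w x) (R w x)) \<and>
      norm (F D x) \<le> K * norm (F T x) \<and> norm (F D x) \<le> K * norm (F R x)"
      using D_int R_int by blast
  next
    assume "\<exists>K>0. \<forall>x. strong_bochner_integrable M (\<lambda>w. ip (D w x) (D w x)) \<and>
      strong_bochner_integrable M (\<lambda>w. ip (R w x) (R w x)) \<and>
      norm (F D x) \<le> K * norm (F T x) \<and> norm (F D x) \<le> K * norm (F R x)"
    then obtain K where K: "0 < K"
      and D_int: "\<And>x. strong_bochner_integrable M (\<lambda>w. ip (D w x) (D w x))"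
      and R_int: "\<And>x. strong_bochner_integrable M (\<lambda>w. ip (R w x) (R w x))"
      and D_T: "\<And>x. norm (F D x) \<le> K * norm (F T x)" and D_R: "\<And>x. norm (F D x) \<le> K * norm (F R x)"
      by blast
    define k where "k = 2 * K + 2"
    have k: "0 < k" using K by (simp add: k_def)
    have T_R: "norm (F T x) \<le> k * norm (F R x)" for x
    proof -
      have "norm (F T x) \<le> 2 * norm (F D x) + 2 * norm (F R x)"
        by (rule norm_integral_ip_add_le[OF has_F[of D, OF D_int] has_F[of R, OF R_int]])
          (use has_F[of T, OF T_int] in \<open>simp add: D_def\<close>)
      with D_R[of x] show ?thesis by (simp add: k_def distrib_right)
    qed
    have R_T: "norm (F R x) \<le> k * norm (F T x)" for x
    proof -
      have "has_strong_bochner_integral M (\<lambda>w. ip (- D w x) (- D w x)) (F D x)"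
        using has_F[of D, OF D_int] by (simp add: ip_minus_left ip_minus_right)
      then have "norm (F R x) \<le> 2 * norm (F D x) + 2 * norm (F T x)"
        by (rule norm_integral_ip_add_le[OF _ has_F[of T, OF T_int]])
          (use has_F[of R, OF R_int] in \<open>simp add: D_def\<close>)
      with D_T[of x] show ?thesis by (simp add: k_def distrib_right)
    qed
    have "continuous_operator_frame_with_bounds M ip R (A / k) (k * B)"
    proof (rule frame_boundsI_norm[OF assms(3)])
      show "0 < A / k" "0 < k * B" using AB k by simp_all
      show "strong_bochner_integrable M (\<lambda>w. ip (R w x) (R w x))" for x by (rule R_int)
      fix x
      have "A * (norm x)\<^sup>2 \<le> k * norm (F R x)" using T_low T_R by (rule order_trans)
      then show "A / k * (norm x)\<^sup>2 \<le> norm (strong_bochner_integral M (\<lambda>w. ip (R w x) (R w x)))"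
        using k by (simp add: F_def field_simps)
      have "k * norm (F T x) \<le> k * (B * (norm x)\<^sup>2)" using T_up k by (intro mult_left_mono) simp_all
      with R_T[of x] show "norm (strong_bochner_integral M (\<lambda>w. ip (R w x) (R w x))) \<le> k * B * (norm x)\<^sup>2"
        by (simp add: F_def mult.assoc)
    qed
    then show "continuous_operator_frame M ip R" unfolding continuous_operator_frame_def by blast
  qed
qed

end
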